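(* Let $K$ be a field and let $S,T\in\mathbf{PRT}$. Let $m$ be the arity of (the root of) $S$ and $n$ the arity of (the root of) $T$, and write $S=S_1\cdot S_2\cdots S_m$, $T=T_1\cdot T_2\cdots T_n$ with $S_i,T_j\in\mathbf{PRT}$, where, if $S=x$, one sets $m=1$ and $S_1=x$, and likewise, if $T=x$, one sets $n=1$ and $T_1=x$. Then, in $K\{x\}_\infty$, $$S\sqcup\!\sqcup T=\sum_{k=2}^{n+m}\ \sum_{(\alpha,\beta)\in\bar\Gamma_k(m,n)}R_{(\alpha,\beta)}.$$
   Context: Trees. A finite planar rooted tree is a (nonempty) finite tree $T$ with a root $\rho_T$ and a linear (left-to-right) order on the set of children of each vertex. The arity of a vertex is the number of its children. $T$ is reduced if no vertex has arity $1$. $\mathbf{PRT}$ is the set of isomorphism classes of finite planar reduced rooted trees, $\mathbf{PRT}'=\{1\}\,\dot\cup\,\mathbf{PRT}$ with $1$ the empty tree, and $x\in\mathbf{PRT}$ is the tree with a single vertex. $L(T)$ is the set of leaves (vertices of arity $0$) of $T$. For $r\ge2$ the $r$-ary grafting $T_1\cdot T_2\cdots T_r=\cdot_r(T_1,\dots,T_r)$ of trees in $\mathbf{PRT}$ adds a new root whose children are, in order, the roots of $T_1,\dots,T_r$. $K\{x\}_\infty$ is the $K$-vector space with basis $\mathbf{PRT}'$; the products $P_1\cdot P_2\cdots P_r$ below are $r$-ary products, the $K$-multilinear extension of $r$-ary grafting (not iterated binary products). Reduction and contraction. For vertices $a,b$ of a finite planar rooted tree $T$, $[a,b]_T$ denotes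 the simple path between them. $\mathrm{Red}(T)$ is the planar reduced rooted tree whose vertices are the vertices of $T$ of arity $\neq1$, whose edges are the pairs $\{a,b\}$ of distinct such vertices for which $[a,b]_T$ contains no vertex of arity $\ne1$ other than $a,b$, whose root is the vertex of arity $\neq1$ closest to $\rho_T$, and whose left-to-right orders are induced from $T$. For $I\subseteq L(T)$ let $T_I:=\bigcup_{a\in I}[a,\rho_T]_T$, a planar rooted tree with root $\rho_T$, and $T|I:=\mathrm{Red}(T_I)$, with $T|\emptyset=1$. Shuffle product. For $S,T,V\in\mathbf{PRT}'$ let $N_{S,T}(V):=\{I\subseteq L(V):V|I=S,\ V|(L(V)-I)=T\}$ and $S\sqcup\!\sqcup T:=\sum_{V\in\mathbf{PRT}'}\sharp N_{S,T}(V)\cdot V$ (a finite sum), $\sharp$ denoting cardinality. Index sets. $\underline{k}=\{1,\dots,k\}$. For a nonempty finite set $\alpha$ of positive integers, $\alpha[i]$ is its $i$-th smallest element. For $k\ge2$ and $m,n\ge1$, $\Gamma_k(m,n)$ is the set of pairs $(\alpha,\beta)$ of nonempty subsets of $\underline{k}$ with $\alpha\cup\beta=\underline{k}$, $\sharp\alpha=m$, $\sharp\beta=n$, and $\bar\Gamma_k(m,n):=\Gamma_k(1,1)\cup\Gamma_k(m,1)\cup\Gamma_k(1,n)\cup\Gamma_k(m,n)$. The elements $R_{(\alpha,\beta)}\in K\{x\}_\infty$, for $(\alpha,\beta)\in\bar\Gamma_k(m,n)$: Case 1: $\sharp\alpha=\sharp\beta=1$ (so $k=2$). $R_{(\alpha,\beta)}:=S\cdot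 T$ if $\alpha=\{1\},\beta=\{2\}$, and $R_{(\alpha,\beta)}:=T\cdot S$ if $\alpha=\{2\},\beta=\{1\}$. Case 2: $\alpha=\{\nu\}$, $\sharp\beta=n>1$ (so $k\in\{n,n+1\}$). If $k=n+1$, then $\beta=\underline{n+1}-\{\nu\}$ and $R_{(\alpha,\beta)}:=T_1\cdots T_{\nu-1}\cdot S\cdot T_\nu\cdot T_{\nu+1}\cdots T_n$ (an $(n+1)$-ary product). If $k=n$, then $\beta=\underline{n}$ and $R_{(\alpha,\beta)}:=T_1\cdots T_{\nu-1}\cdot(T_\nu\sqcup\!\sqcup S)\cdot T_{\nu+1}\cdots T_n$ (an $n$-ary product). Case 2': $\beta=\{\mu\}$, $\sharp\alpha=m>1$ (so $k\in\{m,m+1\}$). If $k=m+1$, then $\alpha=\underline{m+1}-\{\mu\}$ and $R_{(\alpha,\beta)}:=S_1\cdots S_{\mu-1}\cdot T\cdot S_\mu\cdot S_{\mu+1}\cdots S_m$ (an $(m+1)$-ary product). If $k=m$, then $\alpha=\underline{m}$ and $R_{(\alpha,\beta)}:=S_1\cdots S_{\mu-1}\cdot(S_\mu\sqcup\!\sqcup T)\cdot S_{\mu+1}\cdots S_m$ (an $m$-ary product). Case 3: $\sharp\alpha=m>1$, $\sharp\beta=n>1$. $R_{(\alpha,\beta)}:=P_1\cdot P_2\cdots P_k$ ($k$-ary product), where $P_j=S_i$ if $j\in\alpha$, $j\notin\beta$ and $\alpha[i]=j$; $P_j=T_i$ if $j\in\beta$, $j\notin\alpha$ and $\beta[i]=j$;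 and $P_j=S_i\sqcup\!\sqcup T_l$ if $j\in\alpha\cap\beta$, $\alpha[i]=j$ and $\beta[l]=j$. *)

theory Defs
  imports Main "HOL-Library.Poly_Mapping"
begin

text \<open>
  The datatype \<open>ptree\<close> represents isomorphism classes of finite planar rooted trees; \<open>prt\<close> those
  of the reduced ones. The empty tree \<open>1\<close> is \<open>None :: prt option\<close>.
\<close>

datatype ptree = Node (branches: "ptree list")

fun reduced :: "ptree \<Rightarrow> bool" where
  "reduced (Node ts) \<longleftrightarrow> length ts \<noteq> 1 \<and> (\<forall>t\<in>set ts. reduced t)"

typedef prt = "{t. reduced t}"
  by (rule exI[of _ "Node []"]) simp

definition x_tree :: prt where
  "x_tree = Abs_prt (Node [])"

definition root_arity :: "prt \<Rightarrow> nat" where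
  "root_arity S = length (branches (Rep_prt S))"

text \<open>Only meaningful for \<open>length ts \<ge> 2\<close>.\<close>

definition graft :: "prt list \<Rightarrow> prt" where
  "graft ts = Abs_prt (Node (map Rep_prt ts))"

text \<open>
  Planar rooted trees with named vertices. Edges are two-element sets; \<open>before\<close> is the
  left-to-right order, of which only the values on pairs of siblings are significant.
\<close>

record 'v planar_tree =
  verts :: "'v set"
  root :: 'v
  edges :: "'v set set"
  before :: "'v \<Rightarrow> 'v \<Rightarrow> bool"

definition simple_path :: "'v planar_tree \<Rightarrow> 'v \<Rightarrow> 'v list \<Rightarrow> 'v \<Rightarrow> bool" where
  "simple_path T a xs b \<longleftrightarrow>
     xs \<noteq> [] \<and> hd xs = a \<and> last xs = b \<and> distinct xs \<and> set xs \<subseteq> verts T \<and>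
     successively (\<lambda>u v. {u, v} \<in> edges T) xs"

text \<open>The vertices of \<open>[a,b]\<^sub>T\<close>; in a tree there is exactly one simple path from \<open>a\<close> to \<open>b\<close>.\<close>

definition path :: "'v planar_tree \<Rightarrow> 'v \<Rightarrow> 'v \<Rightarrow> 'v set" where
  "path T a b = \<Union> {set xs | xs. simple_path T a xs b}"

definition children :: "'v planar_tree \<Rightarrow> 'v \<Rightarrow> 'v set" where
  "children T u = {v \<in> verts T. {u, v} \<in> edges T \<and> u \<in> path T v (root T)}"

definition arity :: "'v planar_tree \<Rightarrow> 'v \<Rightarrow> nat" where
  "arity T u = card (children T u)"

definition leaves :: "'v planar_tree \<Rightarrow> 'v set" where
  "leaves T = {v \<in> verts T. arity T v = 0}"

definition isomorphic :: "'v planar_tree \<Rightarrow> 'w planar_tree \<Rightarrow> bool" where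
  "isomorphic T U \<longleftrightarrow>
     (\<exists>\<phi>. bij_betw \<phi> (verts T) (verts U) \<and> \<phi> (root T) = root U \<and>
        (\<forall>a\<in>verts T. \<forall>b\<in>verts T. {\<phi> a, \<phi> b} \<in> edges U \<longleftrightarrow> {a, b} \<in> edges T) \<and>
        (\<forall>u\<in>verts T. \<forall>a\<in>children T u. \<forall>b\<in>children T u.
            before U (\<phi> a) (\<phi> b) \<longleftrightarrow> before T a b))"

text \<open>
  \<open>Red(T)\<close>. The order is induced from \<open>T\<close>: \<open>a\<close> is to the left of \<open>b\<close> if some siblings
  \<open>a', b'\<close> of \<open>T\<close> on the paths from \<open>a\<close> and \<open>b\<close> to the root are in this order.
\<close>

definition Red :: "'v planar_tree \<Rightarrow> 'v planar_tree" where
  "Red T = (let W = {v \<in> verts T. arity T v \<noteq> 1} in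
     \<lparr> verts = W,
       root = arg_min_on (\<lambda>v. card (path T v (root T))) W,
       edges = {{a, b} | a b. a \<in> W \<and> b \<in> W \<and> a \<noteq> b \<and> path T a b \<inter> W = {a, b}},
       before = (\<lambda>a b. \<exists>u\<in>verts T. \<exists>a'\<in>children T u. \<exists>b'\<in>children T u.
          a' \<in> path T a (root T) \<and> b' \<in> path T b (root T) \<and> before T a' b') \<rparr>)"

text \<open>\<open>T\<^sub>I\<close>, the union of the paths from the elements of \<open>I\<close> to the root.\<close>

definition span_tree :: "'v planar_tree \<Rightarrow> 'v set \<Rightarrow> 'v planar_tree" where
  "span_tree T I =
     \<lparr> verts = (\<Union>a\<in>I. path T a (root T)),
       root = root T,
       edges = {e \<in> edges T. \<exists>a\<in>I. e \<subseteq> path T a (root T)},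
       before = before T \<rparr>"

text \<open>
  The standard representative of an isomorphism class: vertices are the addresses
  \<open>[i\<^sub>1,\<dots>,i\<^sub>d]\<close>, meaning ``from the root go to child \<open>i\<^sub>1\<close>, then to its child \<open>i\<^sub>2\<close>, \<dots>'',
  where children are numbered from \<open>0\<close>.
\<close>

primrec is_addr :: "nat list \<Rightarrow> ptree \<Rightarrow> bool" where
  "is_addr [] t = True"
| "is_addr (i # p) t = (i < length (branches t) \<and> is_addr p (branches t ! i))"

definition planar_tree_of :: "ptree \<Rightarrow> nat list planar_tree" where
  "planar_tree_of t =
     \<lparr> verts = {p. is_addr p t},
       root = [],
       edges = {{p, p @ [i]} | p i. is_addr (p @ [i]) t},
       before = (\<lambda>p q. \<exists>u i j. p = u @ [i] \<and> q = u @ [j] \<and> i < j) \<rparr>"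

fun Leaves :: "prt option \<Rightarrow> nat list set" where
  "Leaves None = {}"
| "Leaves (Some V) = leaves (planar_tree_of (Rep_prt V))"

text \<open>The contraction \<open>V|I\<close>.\<close>

fun contraction :: "prt option \<Rightarrow> nat list set \<Rightarrow> prt option" where
  "contraction None I = None"
| "contraction (Some V) I =
     (if I = {} then None
      else Some (THE R. isomorphic (Red (span_tree (planar_tree_of (Rep_prt V)) I))
                          (planar_tree_of (Rep_prt R))))"

definition N_set :: "prt option \<Rightarrow> prt option \<Rightarrow> prt option \<Rightarrow> nat list set set" where
  "N_set S T V =
     {I. I \<subseteq> Leaves V \<and> contraction V I = S \<and> contraction V (Leaves V - I) = T}"

text \<open>
  \<open>K{x}\<^sub>\<infinity>\<close> is the type \<open>prt option \<Rightarrow>\<^sub>0 'k\<close> of finitely supported functions.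
\<close>

definition basis :: "prt \<Rightarrow> prt option \<Rightarrow>\<^sub>0 'k::field" where
  "basis t = Poly_Mapping.single (Some t) 1"

definition shuffle :: "prt option \<Rightarrow> prt option \<Rightarrow> prt option \<Rightarrow>\<^sub>0 'k::field" where
  "shuffle S T =
     (\<Sum>V | N_set S T V \<noteq> {}. Poly_Mapping.single V (of_nat (card (N_set S T V))))"

text \<open>
  The multilinear extension of \<open>length ps\<close>-ary grafting to the span of \<open>prt\<close>. Grafting is not
  defined on the empty tree; components along it are ignored.
\<close>

definition grafting :: "(prt option \<Rightarrow>\<^sub>0 'k::field) list \<Rightarrow> prt option \<Rightarrow>\<^sub>0 'k" where
  "grafting ps =
     (\<Sum>ts\<in>listset (map (\<lambda>p. {t. Some t \<in> Poly_Mapping.keys p}) ps).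
        Poly_Mapping.single (Some (graft ts))
          (\<Prod>i<length ps. Poly_Mapping.lookup (ps ! i) (Some (ts ! i))))"

definition Gamma :: "nat \<Rightarrow> nat \<Rightarrow> nat \<Rightarrow> (nat set \<times> nat set) set" where
  "Gamma k m n = {(\<alpha>, \<beta>). \<alpha> \<subseteq> {1..k} \<and> \<beta> \<subseteq> {1..k} \<and> \<alpha> \<noteq> {} \<and> \<beta> \<noteq> {} \<and>
     \<alpha> \<union> \<beta> = {1..k} \<and> card \<alpha> = m \<and> card \<beta> = n}"

definition Gamma_bar :: "nat \<Rightarrow> nat \<Rightarrow> nat \<Rightarrow> (nat set \<times> nat set) set" where
  "Gamma_bar k m n = Gamma k 1 1 \<union> Gamma k m 1 \<union> Gamma k 1 n \<union> Gamma k m n"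

text \<open>\<open>\<alpha>[i]\<close>, with \<open>i\<close> starting from \<open>1\<close>.\<close>

definition ith :: "nat set \<Rightarrow> nat \<Rightarrow> nat" where
  "ith \<alpha> i = sorted_list_of_set \<alpha> ! (i - 1)"

definition index_in :: "nat set \<Rightarrow> nat \<Rightarrow> nat" where
  "index_in \<alpha> j = (THE i. i \<in> {1..card \<alpha>} \<and> ith \<alpha> i = j)"

text \<open>\<open>S\<^sub>i\<close> in the mathematical numbering is \<open>Ss ! (i - 1)\<close>.\<close>

definition P_factor ::
    "prt list \<Rightarrow> prt list \<Rightarrow> nat set \<Rightarrow> nat set \<Rightarrow> nat \<Rightarrow> prt option \<Rightarrow>\<^sub>0 'k::field" where
  "P_factor Ss Ts \<alpha> \<beta> j =
     (let Si = Ss ! (index_in \<alpha> j - 1); Tl = Ts ! (index_in \<beta> j - 1) in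
      if j \<in> \<alpha> \<and> j \<notin> \<beta> then basis Si
      else if j \<in> \<beta> \<and> j \<notin> \<alpha> then basis Tl
      else shuffle (Some Si) (Some Tl))"

definition R_elem ::
    "prt \<Rightarrow> prt list \<Rightarrow> prt \<Rightarrow> prt list \<Rightarrow> nat \<Rightarrow> nat set \<Rightarrow> nat set \<Rightarrow> prt option \<Rightarrow>\<^sub>0 'k::field" where
  "R_elem S Ss T Ts k \<alpha> \<beta> =
     (if card \<alpha> = 1 \<and> card \<beta> = 1 then
        (if \<alpha> = {1} \<and> \<beta> = {2} then grafting [basis S, basis T] else grafting [basis T, basis S])
      else if card \<alpha> = 1 then
        (let \<nu> = the_elem \<alpha> in
         if k = length Ts + 1 then
           grafting (map basis (take (\<nu> - 1) Ts) @ [basis S] @ map basis (drop (\<nu> - 1) Ts))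
         else
           grafting (map basis (take (\<nu> - 1) Ts) @ [shuffle (Some (Ts ! (\<nu> - 1))) (Some S)]
                     @ map basis (drop \<nu> Ts)))
      else if card \<beta> = 1 then
        (let \<mu> = the_elem \<beta> in
         if k = length Ss + 1 then
           grafting (map basis (take (\<mu> - 1) Ss) @ [basis T] @ map basis (drop (\<mu> - 1) Ss))
         else
           grafting (map basis (take (\<mu> - 1) Ss) @ [shuffle (Some (Ss ! (\<mu> - 1))) (Some T)]
                     @ map basis (drop \<mu> Ss)))
      else grafting (map (P_factor Ss Ts \<alpha> \<beta>) [1..<k + 1]))"

text \<open>
  \<open>S = S\<^sub>1 \<cdot> S\<^sub>2 \<cdots> S\<^sub>m\<close> with \<open>m\<close> the arity of the root, with the convention \<open>m = 1\<close>,
  \<open>S\<^sub>1 = x\<close> for \<open>S = x\<close>.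
\<close>

definition decomposition :: "prt \<Rightarrow> prt list \<Rightarrow> bool" where
  "decomposition S Ss \<longleftrightarrow>
     (if S = x_tree then Ss = [x_tree] else length Ss = root_arity S \<and> S = graft Ss)"

end

theory Submission
  imports Defs "HOL-Library.Sublist" "HOL-Library.FuncSet"
begin

text \<open>
  Vertices of \<open>planar_tree_of t\<close>, of \<open>T\<^sub>I\<close> and of \<open>Red(T\<^sub>I)\<close> are all addresses, and in each of these
  trees the edges form the Hasse diagram of the prefix order. Hence a contraction is determined by
  the prefix order and the left-to-right order on the vertices of \<open>T\<^sub>I\<close> of arity other than \<open>1\<close>,
  and it can be computed recursively: contract every branch that meets \<open>I\<close>, then graft the results,
  unless there is just one. Therefore \<open>I \<in> N_set S T V\<close> for \<open>V = V\<^sub>1 \<cdots> V\<^sub>k\<close> restricts to a pair of possibly empty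
  trees on each \<open>V\<^sub>j\<close>, and reading off the branches on which the first (second) tree is nonempty gives
  \<open>\<alpha>\<close> (\<open>\<beta>\<close>). The nonempty trees on \<open>\<alpha>\<close> are \<open>S\<^sub>1, \<dots>, S\<^sub>m\<close>, or \<open>S\<close> alone if \<open>\<alpha>\<close> is a singleton, and
  likewise for \<open>\<beta>\<close>, so the coefficient of \<open>V\<close> splits over \<open>(\<alpha>, \<beta>)\<close> into products of branch
  coefficients, which are the coefficients of the graftings \<open>R_elem\<close>.
\<close>


section \<open>Trees given by the prefix order\<close>

text \<open>Two features of the definitions shape the proof. First, they speak of unordered edges,
  simple paths, a minimising root and a definite description, so no recursion is visible in them.
  Paths have to be identified with intervals of the prefix order before \<open>contraction\<close>
  can be evaluated, and the definite description has a value only because isomorphic standard trees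
  are equal. Second, a single formula has to serve all cases of \<open>R_elem\<close>. For
  \<open>card \<alpha> = 1\<close> all of S lies in one branch of V; for
  \<open>card \<alpha> = m > 1\<close> the root of S is the root of V. The choices for S and T are
  independent, which is why \<open>Gamma_bar\<close> is a union of four sets. Once the list of
  factors is chosen accordingly, every case of \<open>R_elem\<close> takes the form of the last one,
  and an unshuffled factor counts as a shuffle with the empty tree. The counting is done entirely in
  natural numbers, so the characteristic of the field does not enter. The trees 1 and x, which are
  not graftings, have coefficient 0 on both sides.\<close>

lemma simple_path_rev: "simple_path T a xs b \<Longrightarrow> simple_path T b (rev xs) a"
  unfolding simple_path_def by (auto simp: hd_rev last_rev insert_commute)

lemma path_commute: "path T a b = path T b a"
proof -
  have "path T a b \<subseteq> path T b a" for a b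
    unfolding path_def using simple_path_rev[of T a _ b] by auto (metis set_rev)
  then show ?thesis by blast
qed

text \<open>Here \<open>d\<close> is the only gate into \<open>D\<close>: the first step of the walk
  that lands in \<open>D\<close> must land on \<open>d\<close>. Subtrees are such sets, with their
  top vertex as gate.\<close>

lemma walk_enters:
  assumes "successively E xs" "xs \<noteq> []" "hd xs \<notin> D" "last xs \<in> D"
    and "\<And>u v. E u v \<Longrightarrow> u \<notin> D \<Longrightarrow> v \<in> D \<Longrightarrow> v = d"
  shows "d \<in> set xs"
  using assms(1-4)
proof (induction xs rule: induct_list012)
  case (3 x y zs)
  then show ?case using assms(5)[of x y] by (cases "y \<in> D") auto
qed auto

text \<open>A walk that left \<open>D\<close> would have to come back, and both the exit and the
  return pass through the gate \<open>d\<close>; this contradicts distinctness.\<close>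

lemma simple_walk_stays:
  assumes "successively E xs" "distinct xs" "xs \<noteq> []" "hd xs \<in> D" "last xs \<in> D"
    and exit: "\<And>u v. E u v \<Longrightarrow> u \<in> D \<Longrightarrow> v \<notin> D \<Longrightarrow> u = d"
    and entry: "\<And>u v. E u v \<Longrightarrow> u \<notin> D \<Longrightarrow> v \<in> D \<Longrightarrow> v = d"
  shows "set xs \<subseteq> D"
proof (rule ccontr)
  assume "\<not> set xs \<subseteq> D"
  then have "\<exists>w\<in>set xs. w \<notin> D" by blast
  from split_list_first_prop[OF this] obtain ys w zs
    where xs: "xs = ys @ w # zs" "w \<notin> D" "\<forall>y\<in>set ys. y \<in> D" by auto
  from xs assms(4) have ne: "ys \<noteq> []" by (cases ys) auto
  have "E (last ys) w" using assms(1) ne unfolding xs(1) by (auto simp: successively_append_iff)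
  with exit xs ne have d: "last ys = d" by simp
  have "d \<in> set (w # zs)"
  proof (rule walk_enters[of E _ D])
    show "successively E (w # zs)" using assms(1) unfolding xs(1) by (auto simp: successively_append_iff)
    show "last (w # zs) \<in> D" using assms(5) unfolding xs(1) by simp
  qed (use xs entry in auto)
  moreover have "d \<in> set ys" using d ne last_in_set by blast
  ultimately show False using assms(2) unfolding xs(1) by auto
qed

definition covers :: "'a list set \<Rightarrow> 'a list \<Rightarrow> 'a list \<Rightarrow> bool" where
  "covers W a b \<longleftrightarrow> a \<in> W \<and> b \<in> W \<and> strict_prefix a b \<and>
     (\<forall>c\<in>W. strict_prefix a c \<longrightarrow> \<not> strict_prefix c b)"

text \<open>The prefixes of a word form a chain, so a set \<open>W\<close> with a least element has
  a tree as its Hasse diagram, rooted at that element. The field \<open>before\<close> stays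
  outside, because reductions and address trees carry different relations there.\<close>

locale hasse_tree =
  fixes T :: "'a list planar_tree" and W :: "'a list set"
  assumes verts: "verts T = W"
    and root_in: "root T \<in> W"
    and root_least: "w \<in> W \<Longrightarrow> prefix (root T) w"
    and edges: "edges T = {{a, b} | a b. covers W a b}"
begin

lemma edge_iff: "{u, v} \<in> edges T \<longleftrightarrow> covers W u v \<or> covers W v u"
  unfolding edges by (auto simp: doubleton_eq_iff)

text \<open>The parent \<open>u\<close> of \<open>v\<close> and the vertex \<open>d\<close> are both
  prefixes of \<open>v\<close>, hence comparable; if \<open>d\<close> were not \<open>v\<close>
  itself, it would lie strictly between \<open>u\<close> and \<open>v\<close>.\<close>

lemma edge_out_of_subtree:
  assumes "{u, v} \<in> edges T" "d \<in> W" "prefix d v" "\<not> prefix d u"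
  shows "v = d"
proof -
  have "covers W u v"
    using assms unfolding edge_iff covers_def by (meson prefix_order.less_imp_le prefix_order.trans)
  then have "prefix u v" and no: "\<forall>c\<in>W. strict_prefix u c \<longrightarrow> \<not> strict_prefix c v"
    by (auto simp: covers_def strict_prefix_def)
  then have "strict_prefix u d"
    using assms(3,4) prefix_same_cases[of u v d] by (auto simp: strict_prefix_def)
  then show ?thesis using no assms(2,3) by (auto simp: strict_prefix_def)
qed

lemma covers_below:
  assumes "a \<in> W" "b \<in> W" "strict_prefix a b"
  obtains p where "covers W p b" "prefix a p"
proof -
  define P where "P p \<longleftrightarrow> p \<in> W \<and> prefix a p \<and> strict_prefix p b" for p
  have "P a" using assms by (simp add: P_def)
  moreover have "\<forall>y. P y \<longrightarrow> length y < length b"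
    unfolding P_def using prefix_length_less by blast
  ultimately obtain p where p: "P p" "\<And>y. P y \<Longrightarrow> length y \<le> length p"
    using ex_has_greatest_nat[of P a length "length b"] by auto
  have "covers W p b" unfolding covers_def
  proof (intro conjI ballI impI notI)
    fix c assume "c \<in> W" "strict_prefix p c" "strict_prefix c b"
    then have "P c" using p(1) unfolding P_def by (meson prefix_order.less_imp_le prefix_order.trans)
    then show False using p(2) \<open>strict_prefix p c\<close> prefix_length_less by fastforce
  qed (use p(1) assms in \<open>auto simp: P_def\<close>)
  with p(1) that show thesis by (auto simp: P_def)
qed

lemma ex_simple_path:
  assumes "a \<in> W" "b \<in> W" "prefix a b"
  shows "\<exists>xs. simple_path T a xs b \<and> (\<forall>w\<in>set xs. prefix a w \<and> prefix w b)"
  using assms(2,3)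
proof (induction "length b" arbitrary: b rule: less_induct)
  case less
  show ?case
  proof (cases "a = b")
    case True
    then show ?thesis using assms(1) by (intro exI[of _ "[a]"]) (auto simp: simple_path_def verts)
  next
    case False
    with less obtain p where p: "covers W p b" "prefix a p"
      using covers_below[OF assms(1)] by (metis strict_prefix_def)
    then have pb: "p \<in> W" "strict_prefix p b" by (auto simp: covers_def)
    then obtain xs where xs: "simple_path T a xs p" "\<forall>w\<in>set xs. prefix a w \<and> prefix w p"
      using less(1) p(2) prefix_length_less by metis
    have "b \<notin> set xs" using xs(2) pb(2) by (auto simp: strict_prefix_def)
    moreover have "{p, b} \<in> edges T" using p(1) by (simp add: edge_iff)
    ultimately have "simple_path T a (xs @ [b]) b"
      using xs(1) less(2) by (auto simp: simple_path_def successively_append_iff verts)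
    moreover have "\<forall>w\<in>set (xs @ [b]). prefix a w \<and> prefix w b"
      using xs(2) pb(2) less by (auto simp: strict_prefix_def intro: prefix_order.trans)
    ultimately show ?thesis by blast
  qed
qed

text \<open>Three gate arguments: the path cannot leave the subtree of \<open>a\<close>, cannot make
  a detour into the subtree of a \<open>w\<close> that is not a prefix of \<open>b\<close>, and must
  enter the subtree of every \<open>w\<close> in between at its top.\<close>

lemma simple_path_interval:
  assumes "a \<in> W" "b \<in> W" "prefix a b" and xs: "simple_path T a xs b"
  shows "set xs = {w \<in> W. prefix a w \<and> prefix w b}"
proof -
  note sp = xs[unfolded simple_path_def verts]
  have "prefix w b \<and> prefix a w" if w: "w \<in> set xs" for w
  proof
    have W: "w \<in> W" using w sp by blast
    show b: "prefix w b"
    proof (rule ccontr)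
      assume nb: "\<not> prefix w b"
      \<comment> \<open>The root is a prefix of \<open>b\<close>, so \<open>w\<close> is not the
        root and has a parent \<open>q\<close>. This is the only vertex outside the subtree of
        \<open>w\<close> with an edge into it.\<close>
      then have sw: "strict_prefix (root T) w"
        using root_least[OF W] root_least[OF assms(2)] by (auto simp: strict_prefix_def)
      then obtain q where q: "covers W q w" using covers_below[OF root_in W] by blast
      have "set xs \<subseteq> {v. \<not> prefix w v}"
      proof (rule simple_walk_stays[where d = q])
        fix u v assume uv: "{u, v} \<in> edges T"
        have *: "u = q" if uv: "{u, v} \<in> edges T" and "\<not> prefix w u" "prefix w v" for u v
        proof -
          from edge_out_of_subtree[OF uv W] that have "v = w" by blast
          with that have "covers W u w" by (auto simp: edge_iff covers_def strict_prefix_def)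
          then show ?thesis using q unfolding covers_def
            by (metis prefix_same_cases strict_prefix_def)
        qed
        show "u = q" if "u \<in> {v. \<not> prefix w v}" "v \<notin> {v. \<not> prefix w v}"
          using * uv that by auto
        show "v = q" if "u \<notin> {v. \<not> prefix w v}" "v \<in> {v. \<not> prefix w v}"
          using *[of v u] uv that by (auto simp: insert_commute)
      qed (use sp nb assms(3) in \<open>auto dest: prefix_order.trans\<close>)
      with w show False by auto
    qed
    show "prefix a w"
    proof (rule ccontr)
      assume na: "\<not> prefix a w"
      have "set xs \<subseteq> {v. prefix a v}"
      proof (rule simple_walk_stays[where d = a])
        fix u v assume "{u, v} \<in> edges T"
        then show "u \<in> {v. prefix a v} \<Longrightarrow> v \<notin> {v. prefix a v} \<Longrightarrow> u = a"
          and "u \<notin> {v. prefix a v} \<Longrightarrow> v \<in> {v. prefix a v} \<Longrightarrow> v = a"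
          using edge_out_of_subtree[OF _ assms(1)] by (auto simp: insert_commute)
      qed (use sp assms in auto)
      with w na show False by auto
    qed
  qed
  moreover have "w \<in> set xs" if w: "w \<in> W" "prefix a w" "prefix w b" for w
  proof (cases "w = a")
    case True
    then show ?thesis using sp by (metis hd_in_set)
  next
    case False
    show ?thesis
    proof (rule walk_enters[where D = "{v. prefix w v}"])
      show "successively (\<lambda>u v. {u, v} \<in> edges T) xs" using sp by blast
      show "hd xs \<notin> {v. prefix w v}" using sp w False by (auto dest: prefix_order.antisym)
    qed (use sp w edge_out_of_subtree[OF _ w(1)] in auto)
  qed
  ultimately show ?thesis using sp by auto
qed

text \<open>Since \<open>path\<close> is a union over all simple paths, both the existence of one
  and the common vertex set of all of them are used.\<close>

lemma path_interval:
  assumes "a \<in> W" "b \<in> W" "prefix a b"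
  shows "path T a b = {w \<in> W. prefix a w \<and> prefix w b}"
proof -
  let ?P = "{set xs |xs. simple_path T a xs b}" and ?J = "{w \<in> W. prefix a w \<and> prefix w b}"
  have "\<forall>X\<in>?P. X = ?J" using simple_path_interval[OF assms] by auto
  moreover have "?P \<noteq> {}" using ex_simple_path[OF assms] by auto
  ultimately have "?P = {?J}" by blast
  then show ?thesis by (simp add: path_def)
qed

lemma path_to_root: "v \<in> W \<Longrightarrow> path T v (root T) = {w \<in> W. prefix w v}"
  using path_interval[OF root_in, of v] path_commute[of T v "root T"] root_least by auto

lemma children: "u \<in> W \<Longrightarrow> children T u = {v. covers W u v}"
  unfolding children_def verts edge_iff
  by (auto simp: path_to_root covers_def strict_prefix_def)

text \<open>The paths from \<open>c\<close> to \<open>a\<close> and to \<open>b\<close> are glued at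
  \<open>c\<close>. A common vertex is a prefix of both ends, hence of \<open>c\<close>, hence equal
  to \<open>c\<close>. This later rules out edges between incomparable vertices of a
  reduction.\<close>

lemma meet_in_path:
  assumes "a \<in> W" "b \<in> W" "c \<in> W" "c = longest_common_prefix a b"
  shows "c \<in> path T a b"
proof -
  have pre: "prefix c a" "prefix c b"
    by (auto simp: assms(4) longest_common_prefix_prefix1 longest_common_prefix_prefix2)
  obtain xs where xs: "simple_path T c xs a" "\<forall>w\<in>set xs. prefix c w \<and> prefix w a"
    using ex_simple_path[OF assms(3,1) pre(1)] by blast
  obtain ys where ys: "simple_path T c ys b" "\<forall>w\<in>set ys. prefix c w \<and> prefix w b"
    using ex_simple_path[OF assms(3,2) pre(2)] by blast
  obtain ys' where ys': "ys = c # ys'" using ys(1) by (cases ys) (auto simp: simple_path_def)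
  have "w = c" if "w \<in> set xs" "w \<in> set ys" for w
    using that xs(2) ys(2) longest_common_prefix_max_prefix[of w a b] assms(4)
    by (auto intro: prefix_order.antisym)
  then have "distinct (rev xs @ ys')" using xs(1) ys(1) ys' by (auto simp: simple_path_def)
  moreover have "successively (\<lambda>u v. {u, v} \<in> edges T) (rev xs @ ys')"
    using simple_path_rev[OF xs(1)] ys(1) unfolding ys' simple_path_def
    by (auto simp: successively_append_iff successively_Cons)
  ultimately have "simple_path T a (rev xs @ ys') b"
    using simple_path_rev[OF xs(1)] xs(1) ys(1) unfolding ys' simple_path_def
    by (auto split: if_splits)
  moreover have "c \<in> set (rev xs @ ys')" using xs(1) by (auto simp: simple_path_def)
  ultimately show ?thesis unfolding path_def by blast
qed

end


section \<open>Spanned subtrees and reductions\<close>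

definition prefix_closed :: "'a list set \<Rightarrow> bool" where
  "prefix_closed A \<longleftrightarrow> (\<forall>v\<in>A. \<forall>w. prefix w v \<longrightarrow> w \<in> A)"

lemma prefix_closedD: "prefix_closed A \<Longrightarrow> v \<in> A \<Longrightarrow> prefix w v \<Longrightarrow> w \<in> A"
  by (auto simp: prefix_closed_def)

lemma covers_prefix_closed:
  assumes "prefix_closed A"
  shows "covers A u v \<longleftrightarrow> v \<in> A \<and> (\<exists>i. v = u @ [i])"
proof
  assume c: "covers A u v"
  then obtain i q where v: "v = u @ i # q"
    unfolding covers_def strict_prefix_def prefix_def by (metis append_Nil2 neq_Nil_conv)
  have "v \<in> A" "prefix (u @ [i]) v" using c v by (simp_all add: covers_def)
  then have "u @ [i] \<in> A" using assms prefix_closedD by blast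
  moreover have "strict_prefix u (u @ [i])" by (simp add: strict_prefix_def)
  ultimately have "\<not> strict_prefix (u @ [i]) v" using c by (simp add: covers_def)
  then have "q = []" using v by (auto simp: strict_prefix_def)
  with v c show "v \<in> A \<and> (\<exists>i. v = u @ [i])" by (auto simp: covers_def)
next
  assume "v \<in> A \<and> (\<exists>i. v = u @ [i])"
  then obtain i where v: "v \<in> A" "v = u @ [i]" by blast
  then have "u \<in> A" using assms by (auto dest: prefix_closedD[where w = u])
  with v show "covers A u v" by (auto simp: covers_def strict_prefix_def)
qed

text \<open>The lexicographic order restricted to addresses that are incomparable for
  \<open>prefix\<close>. It is needed beyond siblings because the children of a vertex in a
  reduction need not be siblings in the original tree.\<close>

definition left_of :: "nat list \<Rightarrow> nat list \<Rightarrow> bool" where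
  "left_of a b \<longleftrightarrow> (\<exists>u i j p q. a = u @ i # p \<and> b = u @ j # q \<and> i < j)"

lemma left_of_Cons: "left_of (i # p) (j # q) \<longleftrightarrow> i < j \<or> i = j \<and> left_of p q"
proof
  assume "left_of (i # p) (j # q)"
  then obtain u k l p' q' where *: "i # p = u @ k # p'" "j # q = u @ l # q'" "k < l"
    unfolding left_of_def by blast
  then show "i < j \<or> i = j \<and> left_of p q"
    by (cases u) (auto simp: left_of_def)
next
  assume "i < j \<or> i = j \<and> left_of p q"
  then show "left_of (i # p) (j # q)"
  proof
    assume "i < j"
    then have "i # p = [] @ i # p \<and> j # q = [] @ j # q \<and> i < j" by simp
    then show ?thesis unfolding left_of_def by blast
  next
    assume "i = j \<and> left_of p q"
    then obtain u k l p' q' where "i # p = (i # u) @ k # p'" "j # q = (i # u) @ l # q'" "k < l"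
      unfolding left_of_def by auto
    then show ?thesis unfolding left_of_def by blast
  qed
qed

lemma not_left_of_Nil [simp]: "\<not> left_of [] b" "\<not> left_of a []"
  by (auto simp: left_of_def)

lemma left_of_siblings: "left_of (u @ [i]) (u @ [j]) \<longleftrightarrow> i < j"
  by (induction u) (auto simp: left_of_Cons)

lemma longest_common_prefix_branch:
  "i \<noteq> j \<Longrightarrow> longest_common_prefix (u @ i # p) (u @ j # q) = u"
  by (induction u) auto

lemma is_addr_appendD: "is_addr (p @ q) t \<Longrightarrow> is_addr p t"
  by (induction p arbitrary: t) auto

lemma prefix_closed_addresses: "prefix_closed {p. is_addr p t}"
  using is_addr_appendD by (auto simp: prefix_closed_def prefix_def)

lemma addresses_Node:
  "{p. is_addr p (Node ts)} = insert [] (\<Union>i<length ts. (#) i ` {p. is_addr p (ts ! i)})"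
proof -
  have "is_addr p (Node ts) \<longleftrightarrow>
      p \<in> insert [] (\<Union>i<length ts. (#) i ` {p. is_addr p (ts ! i)})" for p
    by (cases p) auto
  then show ?thesis by blast
qed

lemma finite_addresses: "finite {p. is_addr p t}"
  by (induction t) (simp add: addresses_Node)

lemma hasse_tree_planar_tree_of: "hasse_tree (planar_tree_of t) {p. is_addr p t}"
  by unfold_locales
    (auto simp: planar_tree_of_def covers_prefix_closed[OF prefix_closed_addresses])

lemma children_planar_tree_of:
  "is_addr u t \<Longrightarrow> children (planar_tree_of t) u = {u @ [i] | i. is_addr (u @ [i]) t}"
  using hasse_tree.children[OF hasse_tree_planar_tree_of, of u t]
  by (auto simp: covers_prefix_closed[OF prefix_closed_addresses])

lemma leaves_planar_tree_of:
  "leaves (planar_tree_of t) = {p. is_addr p t \<and> (\<forall>i. \<not> is_addr (p @ [i]) t)}"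
proof -
  \<comment> \<open>The arity is a \<open>card\<close>, which is 0 for infinite sets as well;
    finiteness turns arity 0 into the absence of children.\<close>
  have "finite (children (planar_tree_of t) u)" for u
    by (rule finite_subset[OF _ finite_addresses[of t]])
      (auto simp: children_def planar_tree_of_def)
  then have "leaves (planar_tree_of t) =
      {p. is_addr p t \<and> children (planar_tree_of t) p = {}}"
    by (auto simp: leaves_def arity_def planar_tree_of_def)
  then show ?thesis by (auto simp: children_planar_tree_of)
qed

definition ancestors :: "'a list set \<Rightarrow> 'a list set" where
  "ancestors I = {w. \<exists>a\<in>I. prefix w a}"

definition unary_free :: "'a list set \<Rightarrow> 'a list set" where
  "unary_free A = {v \<in> A. card {i. v @ [i] \<in> A} \<noteq> 1}"

lemma prefix_closed_ancestors: "prefix_closed (ancestors I)"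
  by (auto simp: prefix_closed_def ancestors_def intro: prefix_order.trans)

lemma ancestors_addresses:
  "I \<subseteq> {p. is_addr p t} \<Longrightarrow> ancestors I \<subseteq> {p. is_addr p t}"
  using is_addr_appendD by (fastforce simp: ancestors_def prefix_def)

text \<open>An edge between \<open>p\<close> and \<open>p @ [i]\<close> is kept as soon as its lower
  end \<open>p @ [i]\<close> lies above a selected vertex, because \<open>p\<close> then lies on the
  same path to the root.\<close>

lemma hasse_tree_span_tree:
  assumes I: "I \<subseteq> {p. is_addr p t}" and ne: "I \<noteq> {}"
  shows "hasse_tree (span_tree (planar_tree_of t) I) (ancestors I)"
proof -
  interpret P: hasse_tree "planar_tree_of t" "{p. is_addr p t}"
    by (rule hasse_tree_planar_tree_of)
  have root: "root (planar_tree_of t) = []" by (simp add: planar_tree_of_def)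
  have path: "path (planar_tree_of t) a [] = {w. prefix w a}" if "a \<in> I" for a
    using P.path_to_root[of a] I that is_addr_appendD by (fastforce simp: root prefix_def)
  have "edges (span_tree (planar_tree_of t) I) =
      {e \<in> edges (planar_tree_of t). \<exists>a\<in>I. e \<subseteq> {w. prefix w a}}"
    by (auto simp: span_tree_def root path)
  also have "\<dots> = {{p, p @ [i]} | p i. p @ [i] \<in> ancestors I}" (is "?L = ?R")
  proof
    show "?L \<subseteq> ?R"
    proof
      fix e assume "e \<in> ?L"
      then obtain p i a where "e = {p, p @ [i]}" "a \<in> I" "prefix (p @ [i]) a"
        by (auto simp: planar_tree_of_def)
      then show "e \<in> ?R" unfolding ancestors_def by blast
    qed
    show "?R \<subseteq> ?L"
    proof
      fix e assume "e \<in> ?R"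
      then obtain p i where e: "e = {p, p @ [i]}" "p @ [i] \<in> ancestors I" by blast
      then obtain a where a: "a \<in> I" "prefix (p @ [i]) a" by (auto simp: ancestors_def)
      then have "e \<subseteq> {w. prefix w a}" using e(1) append_prefixD by auto
      moreover have "is_addr (p @ [i]) t" using ancestors_addresses[OF I] e(2) by blast
      then have "e \<in> edges (planar_tree_of t)" using e(1) by (auto simp: planar_tree_of_def)
      ultimately show "e \<in> ?L" using a(1) by blast
    qed
  qed
  also have "\<dots> = {{a, b} | a b. covers (ancestors I) a b}"
    by (auto simp: covers_prefix_closed[OF prefix_closed_ancestors])
  finally have e: "edges (span_tree (planar_tree_of t) I) = \<dots>" .
  show ?thesis
    by unfold_locales (use e ne in \<open>auto simp: span_tree_def root path ancestors_def\<close>)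
qed

text \<open>At their longest common prefix the two addresses continue into different children, so
  that vertex does not have arity 1.\<close>

lemma unary_free_branch:
  assumes "prefix_closed A" "finite A" "a \<in> A" "b \<in> A" "a \<parallel> b"
  shows "longest_common_prefix a b \<in> unary_free A"
proof -
  from parallel_decomp[OF assms(5)] obtain u i p j q
    where ij: "i \<noteq> j" and ab: "a = u @ i # p" "b = u @ j # q" by blast
  have in_A: "u @ [i] \<in> A" "u @ [j] \<in> A" "u \<in> A"
    using prefix_closedD[OF assms(1,3)] prefix_closedD[OF assms(1,4)] ab by auto
  have "card {i. u @ [i] \<in> A} \<noteq> 1"
  proof
    assume "card {i. u @ [i] \<in> A} = 1"
    then obtain k where "{i. u @ [i] \<in> A} = {k}" by (auto simp: card_1_singleton_iff)
    then have "i = k" "j = k" using in_A by blast+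
    with ij show False by simp
  qed
  then show ?thesis using in_A ij by (simp add: ab longest_common_prefix_branch unary_free_def)
qed

lemma prefix_closed_card_prefixes:
  assumes "prefix_closed A" "v \<in> A"
  shows "card {w \<in> A. prefix w v} = Suc (length v)"
proof -
  have "{w \<in> A. prefix w v} = set (prefixes v)"
    using prefix_closedD[OF assms] by auto
  then show ?thesis by (simp add: distinct_card)
qed

text \<open>Deleting the vertices of arity 1 keeps all branching points. Incomparable survivors are
  therefore separated by a survivor, and the reduction is again a Hasse diagram.\<close>

lemma
  assumes "hasse_tree T A" and pc: "prefix_closed A" and fin: "finite A"
    and before: "before T = (\<lambda>p q. \<exists>u i j. p = u @ [i] \<and> q = u @ [j] \<and> i < j)"
  shows hasse_tree_Red: "hasse_tree (Red T) (unary_free A)"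
    and before_Red: "a \<in> unary_free A \<Longrightarrow> b \<in> unary_free A \<Longrightarrow>
      before (Red T) a b \<longleftrightarrow> left_of a b"
proof -
  interpret H: hasse_tree T A by fact
  let ?W = "unary_free A"
  have W: "?W \<subseteq> A" by (auto simp: unary_free_def)
  have child: "children T u = {u @ [i] | i. u @ [i] \<in> A}" if "u \<in> A" for u
    using H.children[OF that] by (auto simp: covers_prefix_closed[OF pc])
  have "arity T u = card {i. u @ [i] \<in> A}" if "u \<in> A" for u
  proof -
    have "children T u = (\<lambda>i. u @ [i]) ` {i. u @ [i] \<in> A}" using child[OF that] by auto
    then show ?thesis by (simp add: arity_def card_image inj_on_def)
  qed
  then have W_eq: "{v \<in> verts T. arity T v \<noteq> 1} = ?W"
    by (auto simp: H.verts unary_free_def)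
  have root: "root T = []"
    using H.root_least[of "[]"] prefix_closedD[OF pc H.root_in, of "[]"] by simp
  have card: "card (path T v (root T)) = Suc (length v)" if "v \<in> A" for v
    using H.path_to_root[OF that] prefix_closed_card_prefixes[OF pc that] by simp
  \<comment> \<open>A vertex of maximal depth has arity 0 and survives; hence the minimum that
    defines the root is taken over a nonempty set.\<close>
  have "Max (length ` A) \<in> length ` A" using fin H.root_in by (intro Max_in) auto
  then obtain v where v: "v \<in> A" "length v = Max (length ` A)" by auto
  have "length w \<le> length v" if "w \<in> A" for w using that fin v(2) by simp
  then have "v @ [i] \<notin> A" for i by force
  then have "{i. v @ [i] \<in> A} = {}" by simp
  with v(1) have "v \<in> ?W" by (simp add: unary_free_def)
  then have ne: "?W \<noteq> {}" by blast
  define r where "r = arg_min_on (\<lambda>v. card (path T v (root T))) ?W"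
  have finW: "finite ?W" using fin W finite_subset by blast
  have r: "r \<in> ?W" "\<And>w. w \<in> ?W \<Longrightarrow> length r \<le> length w"
    using arg_min_if_finite[OF finW ne, of "\<lambda>v. card (path T v (root T))"] W card
    unfolding r_def by (auto simp: not_less subset_iff)
  have Red: "verts (Red T) = ?W" "root (Red T) = r"
    "edges (Red T) = {{a, b} |a b. a \<in> ?W \<and> b \<in> ?W \<and> a \<noteq> b \<and> path T a b \<inter> ?W = {a, b}}"
    unfolding Red_def Let_def W_eq r_def by simp_all
  \<comment> \<open>A shortest survivor is least: if \<open>r\<close> and \<open>w\<close> were
    incomparable, their branching point would be a shorter survivor.\<close>
  have least: "prefix r w" if w: "w \<in> ?W" for w
  proof (rule ccontr)
    let ?c = "longest_common_prefix r w"
    assume n: "\<not> prefix r w"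
    moreover have "prefix w r \<Longrightarrow> w = r"
      using r(2)[OF w] by (metis append_eq_conv_conj prefix_def take_all)
    ultimately have "r \<parallel> w" by auto
    then have "?c \<in> ?W" using unary_free_branch[OF pc fin] r(1) w W by blast
    then have "length r \<le> length ?c" by (rule r(2))
    then have "?c = r" using longest_common_prefix_prefix1[of r w]
      by (metis append_eq_conv_conj prefix_def take_all)
    with n show False by (metis longest_common_prefix_prefix2)
  qed
  have cov: "covers ?W a b \<longleftrightarrow> path T a b \<inter> ?W = {a, b} \<and> a \<noteq> b"
    if "a \<in> ?W" "b \<in> ?W" "prefix a b" for a b
  proof -
    have "path T a b \<inter> ?W = {w \<in> ?W. prefix a w \<and> prefix w b}"
      using H.path_interval[of a b] that W by auto
    with that show ?thesis by (auto simp: covers_def strict_prefix_def set_eq_iff)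
  qed
  \<comment> \<open>For incomparable ends the branching point is a third survivor on the path; for
    comparable ends the path is an interval and the condition says that nothing survives in
    between.\<close>
  have edge: "path T a b \<inter> ?W = {a, b} \<and> a \<noteq> b \<longleftrightarrow> covers ?W a b \<or> covers ?W b a"
    if ab: "a \<in> ?W" "b \<in> ?W" for a b
  proof (cases "a \<parallel> b")
    case True
    have "longest_common_prefix a b \<in> path T a b \<inter> ?W"
      using H.meet_in_path[of a b] unary_free_branch[OF pc fin _ _ True] ab W by blast
    moreover have "longest_common_prefix a b \<noteq> a" "longest_common_prefix a b \<noteq> b"
      using True by (metis longest_common_prefix_prefix1 longest_common_prefix_prefix2 parallelE)+
    ultimately show ?thesis using True by (auto simp: covers_def strict_prefix_def)
  next
    case False
    then consider "prefix a b" | "prefix b a" by blast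
    then show ?thesis
    proof cases
      case 1
      then show ?thesis using cov[OF ab 1] by (auto simp: covers_def strict_prefix_def)
    next
      case 2
      then show ?thesis using cov[OF ab(2,1) 2] path_commute[of T a b]
        by (auto simp: covers_def strict_prefix_def insert_commute)
    qed
  qed
  show "hasse_tree (Red T) ?W"
  proof
    show "edges (Red T) = {{a, b} |a b. covers ?W a b}"
    proof (intro equalityI subsetI)
      fix e assume "e \<in> edges (Red T)"
      then obtain a b where e: "e = {a, b}" "e = {b, a}" and "covers ?W a b \<or> covers ?W b a"
        unfolding Red(3) using edge by (auto simp: insert_commute)
      then show "e \<in> {{a, b} |a b. covers ?W a b}" by blast
    next
      fix e assume "e \<in> {{a, b} |a b. covers ?W a b}"
      then obtain a b where "e = {a, b}" and c: "covers ?W a b" by blast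
      moreover from c have "a \<in> ?W" "b \<in> ?W" by (simp_all add: covers_def)
      ultimately show "e \<in> edges (Red T)" unfolding Red(3) using edge[of a b] by blast
    qed
  qed (use Red r least in auto)
  assume ab: "a \<in> ?W" "b \<in> ?W"
  then have abA: "a \<in> A" "b \<in> A" using W by auto
  have anc: "path T w (root T) = {v. prefix v w}" if "w \<in> A" for w
    using H.path_to_root[OF that] prefix_closedD[OF pc that] by auto
  have "before (Red T) a b \<longleftrightarrow> (\<exists>u\<in>A. \<exists>a'\<in>children T u. \<exists>b'\<in>children T u.
      a' \<in> path T a (root T) \<and> b' \<in> path T b (root T) \<and> before T a' b')"
    by (simp add: Red_def Let_def H.verts)
  also have "\<dots> \<longleftrightarrow> (\<exists>u i j. prefix (u @ [i]) a \<and> prefix (u @ [j]) b \<and> i < j)"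
  proof
    assume "\<exists>u\<in>A. \<exists>a'\<in>children T u. \<exists>b'\<in>children T u.
      a' \<in> path T a (root T) \<and> b' \<in> path T b (root T) \<and> before T a' b'"
    then show "\<exists>u i j. prefix (u @ [i]) a \<and> prefix (u @ [j]) b \<and> i < j"
      using abA by (auto simp: anc before)
  next
    assume "\<exists>u i j. prefix (u @ [i]) a \<and> prefix (u @ [j]) b \<and> i < j"
    then obtain u i j where *: "prefix (u @ [i]) a" "prefix (u @ [j]) b" "i < j" by blast
    then have "u @ [i] \<in> A" "u @ [j] \<in> A"
      using abA prefix_closedD[OF pc] by blast+
    moreover then have "u \<in> A" using prefix_closedD[OF pc, of "u @ [i]" u] by simp
    ultimately show "\<exists>u\<in>A. \<exists>a'\<in>children T u. \<exists>b'\<in>children T u.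
        a' \<in> path T a (root T) \<and> b' \<in> path T b (root T) \<and> before T a' b'"
      using * abA by (intro bexI[of _ u] bexI[of _ "u @ [i]"] bexI[of _ "u @ [j]"])
        (auto simp: anc before child)
  qed
  also have "\<dots> \<longleftrightarrow> left_of a b"
    by (simp add: left_of_def prefix_def)
  finally show "before (Red T) a b \<longleftrightarrow> left_of a b" .
qed


section \<open>Isomorphisms\<close>

text \<open>\<open>isomorphic\<close> is split with its map exposed: the unordered half alone
  already carries children to children, which is what the order half needs when maps are inverted or
  composed.\<close>

definition tree_iso :: "('v \<Rightarrow> 'w) \<Rightarrow> 'v planar_tree \<Rightarrow> 'w planar_tree \<Rightarrow> bool" where
  "tree_iso \<phi> T U \<longleftrightarrow> bij_betw \<phi> (verts T) (verts U) \<and> \<phi> (root T) = root U \<and>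
     (\<forall>a\<in>verts T. \<forall>b\<in>verts T. {\<phi> a, \<phi> b} \<in> edges U \<longleftrightarrow> {a, b} \<in> edges T)"

definition keeps_order :: "('v \<Rightarrow> 'w) \<Rightarrow> 'v planar_tree \<Rightarrow> 'w planar_tree \<Rightarrow> bool" where
  "keeps_order \<phi> T U \<longleftrightarrow> (\<forall>u\<in>verts T. \<forall>a\<in>children T u. \<forall>b\<in>children T u.
     before U (\<phi> a) (\<phi> b) \<longleftrightarrow> before T a b)"

lemma isomorphic_iff: "isomorphic T U \<longleftrightarrow> (\<exists>\<phi>. tree_iso \<phi> T U \<and> keeps_order \<phi> T U)"
  by (simp add: isomorphic_def tree_iso_def keeps_order_def)

lemma tree_iso_simple_path:
  assumes iso: "tree_iso \<phi> T U" and xs: "simple_path T a xs b"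
  shows "simple_path U (\<phi> a) (map \<phi> xs) (\<phi> b)"
proof -
  have sub: "set xs \<subseteq> verts T" using xs by (simp add: simple_path_def)
  have "successively (\<lambda>u v. {u, v} \<in> edges U) (map \<phi> xs)"
    unfolding successively_map
    by (rule successively_mono) (use xs iso sub in \<open>auto simp: simple_path_def tree_iso_def subset_iff\<close>)
  moreover have "distinct (map \<phi> xs)"
    using xs iso sub by (auto simp: simple_path_def tree_iso_def distinct_map bij_betw_def inj_on_subset)
  moreover have "\<phi> ` set xs \<subseteq> verts U"
    using iso sub by (auto simp: tree_iso_def bij_betw_def)
  ultimately show ?thesis using xs by (auto simp: simple_path_def hd_map last_map)
qed

text \<open>Which end of an edge is the child is decided by the simple path to the root, and simple
  paths are mapped to simple paths.\<close>

lemma tree_iso_children: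
  assumes iso: "tree_iso \<phi> T U" and u: "u \<in> verts T" and a: "a \<in> children T u"
  shows "\<phi> a \<in> children U (\<phi> u)"
proof -
  from a obtain xs where aT: "a \<in> verts T" "{u, a} \<in> edges T"
    and xs: "simple_path T a xs (root T)" "u \<in> set xs"
    unfolding children_def path_def by blast
  have "\<phi> u \<in> path U (\<phi> a) (root U)"
    using tree_iso_simple_path[OF iso xs(1)] xs(2) iso unfolding path_def tree_iso_def
    by (metis (mono_tags, lifting) UnionI image_eqI mem_Collect_eq set_map)
  then show ?thesis using aT u iso by (auto simp: children_def tree_iso_def bij_betw_def)
qed

text \<open>The record type does not force the root to be a vertex; being one, it is the value of
  the inverse at \<open>root U\<close>.\<close>

lemma tree_iso_inv:
  assumes "tree_iso \<phi> T U" "root T \<in> verts T"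
  shows "tree_iso (inv_into (verts T) \<phi>) U T"
proof -
  let ?g = "inv_into (verts T) \<phi>"
  have bij: "bij_betw \<phi> (verts T) (verts U)" using assms(1) by (simp add: tree_iso_def)
  have "bij_betw ?g (verts U) (verts T)" using bij by (rule bij_betw_inv_into)
  moreover have "?g (root U) = root T"
    using assms bij by (auto simp: tree_iso_def bij_betw_def dest: inv_into_f_f)
  moreover have "\<phi> (?g a) = a" "?g a \<in> verts T" if "a \<in> verts U" for a
    using bij that by (simp_all add: bij_betw_inv_into_right bij_betw_def inv_into_into)
  then have "{?g a, ?g b} \<in> edges T \<longleftrightarrow> {a, b} \<in> edges U" if "a \<in> verts U" "b \<in> verts U" for a b
    using assms(1) that unfolding tree_iso_def by metis
  ultimately show ?thesis unfolding tree_iso_def by blast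
qed

lemma tree_iso_comp:
  assumes "tree_iso \<phi> T U" "tree_iso \<psi> U V"
  shows "tree_iso (\<psi> \<circ> \<phi>) T V"
  using assms unfolding tree_iso_def by (auto simp: bij_betwE intro: bij_betw_trans)

lemma keeps_order_inv:
  assumes iso: "tree_iso \<phi> T U" and root: "root T \<in> verts T" and ord: "keeps_order \<phi> T U"
  shows "keeps_order (inv_into (verts T) \<phi>) U T"
  unfolding keeps_order_def
proof (intro ballI)
  let ?g = "inv_into (verts T) \<phi>"
  fix u a b assume u: "u \<in> verts U" and ab: "a \<in> children U u" "b \<in> children U u"
  have bij: "bij_betw \<phi> (verts T) (verts U)" using iso by (simp add: tree_iso_def)
  have "?g u \<in> verts T" using bij u by (simp add: bij_betw_def inv_into_into)
  moreover have "?g a \<in> children T (?g u)" "?g b \<in> children T (?g u)"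
    using tree_iso_children[OF tree_iso_inv[OF iso root] u] ab by blast+
  moreover have "\<phi> (?g a) = a" "\<phi> (?g b) = b"
    using bij ab by (auto simp: bij_betw_inv_into_right children_def)
  ultimately show "before T (?g a) (?g b) \<longleftrightarrow> before U a b"
    using ord unfolding keeps_order_def by metis
qed

lemma isomorphic_sym:
  assumes "isomorphic T U" "root T \<in> verts T"
  shows "isomorphic U T"
  using assms tree_iso_inv keeps_order_inv unfolding isomorphic_iff by blast

lemma isomorphic_trans:
  assumes "isomorphic T U" "isomorphic U V"
  shows "isomorphic T V"
proof -
  obtain \<phi> \<psi> where \<phi>: "tree_iso \<phi> T U" "keeps_order \<phi> T U"
    and \<psi>: "tree_iso \<psi> U V" "keeps_order \<psi> U V"
    using assms unfolding isomorphic_iff by blast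
  have "keeps_order (\<psi> \<circ> \<phi>) T V" unfolding keeps_order_def
  proof (intro ballI)
    fix u a b assume u: "u \<in> verts T" and ab: "a \<in> children T u" "b \<in> children T u"
    then have "\<phi> a \<in> children U (\<phi> u)" "\<phi> b \<in> children U (\<phi> u)"
      using tree_iso_children[OF \<phi>(1)] by blast+
    moreover have "\<phi> u \<in> verts U" using \<phi>(1) u by (auto simp: tree_iso_def bij_betwE)
    ultimately show "before V ((\<psi> \<circ> \<phi>) a) ((\<psi> \<circ> \<phi>) b) \<longleftrightarrow> before T a b"
      using \<phi>(2) \<psi>(2) u ab unfolding keeps_order_def by simp
  qed
  with tree_iso_comp[OF \<phi>(1) \<psi>(1)] show ?thesis unfolding isomorphic_iff by blast
qed

lemma addresses_inject:
  "{p. is_addr p t} = {p. is_addr p t'} \<Longrightarrow> t = t'"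
proof (induction t arbitrary: t')
  case (Node ts)
  obtain ts' where t': "t' = Node ts'" by (cases t')
  have eq: "is_addr p (Node ts) \<longleftrightarrow> is_addr p (Node ts')" for p using Node.prems t' by blast
  have "\<forall>i. i < length ts \<longleftrightarrow> i < length ts'" using eq[of "[_]"] by simp
  then have len: "length ts = length ts'" by (metis less_irrefl linorder_neqE_nat)
  moreover have "ts ! i = ts' ! i" if "i < length ts" for i
    using Node.IH[of "ts ! i" "ts' ! i"] eq[of "i # _"] that len by auto
  ultimately show ?case using t' by (simp add: nth_equalityI)
qed

text \<open>Counting up from 0 gives \<open>i \<le> f i\<close>; counting down from the largest
  value gives the reverse inequality.\<close>

lemma strict_mono_bij_lessThan:
  fixes f :: "nat \<Rightarrow> nat"
  assumes bij: "bij_betw f {..<k} {..<l}" and mono: "\<And>i j. i < j \<Longrightarrow> j < k \<Longrightarrow> f i < f j"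
    and i: "i < k"
  shows "f i = i"
proof -
  have kl: "k = l" using bij_betw_same_card[OF bij] by simp
  have ge: "i < k \<Longrightarrow> i \<le> f i" for i
  proof (induction i)
    case (Suc i)
    then show ?case using mono[of i "Suc i"] by simp
  qed simp
  have "d < k \<Longrightarrow> f (k - Suc d) \<le> k - Suc d" for d
  proof (induction d)
    case 0
    then have "f (k - Suc 0) < l" using bij_betwE[OF bij] by auto
    with kl show ?case by simp
  next
    case (Suc d)
    then have "f (k - Suc (Suc d)) < f (k - Suc d)" by (intro mono) auto
    then show ?case using Suc by simp
  qed
  from this[of "k - Suc i"] ge[OF i] i show ?thesis by simp
qed

text \<open>Planar trees are rigid. By induction along addresses the isomorphism fixes every vertex:
  on the numbered children of a fixed vertex it is an increasing bijection of initial segments,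
  hence the identity. This gives uniqueness for the definite description in
  \<open>contraction\<close>.\<close>

lemma isomorphic_planar_tree_ofD:
  assumes "isomorphic (planar_tree_of t) (planar_tree_of t')"
  shows "t = t'"
proof -
  let ?T = "planar_tree_of t" and ?U = "planar_tree_of t'"
  have vT: "verts ?T = {p. is_addr p t}" "root ?T = []"
    and vU: "verts ?U = {p. is_addr p t'}" "root ?U = []"
    by (simp_all add: planar_tree_of_def)
  obtain \<phi> where iso: "tree_iso \<phi> ?T ?U" and ord: "keeps_order \<phi> ?T ?U"
    using assms unfolding isomorphic_iff by blast
  have bij: "bij_betw \<phi> (verts ?T) (verts ?U)" using iso by (simp add: tree_iso_def)
  \<comment> \<open>Children are numbered consecutively from 0. If \<open>u\<close> is not an
    address of \<open>s\<close>, the set is empty and \<open>k = 0\<close> serves.\<close>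
  have interval: "\<exists>k. {i. is_addr (u @ [i]) s} = {..<k}" for u s
  proof (induction u arbitrary: s)
    case Nil
    then show ?case by auto
  next
    case (Cons a u)
    then show ?case by (cases "a < length (branches s)") (auto intro: exI[of _ 0])
  qed
  have fix_points: "is_addr p t \<Longrightarrow> \<phi> p = p" for p
  proof (induction p rule: rev_induct)
    case Nil
    then show ?case using iso by (simp add: tree_iso_def vT vU)
  next
    case (snoc i p)
    have p: "is_addr p t" using snoc.prems by (rule is_addr_appendD)
    with snoc.IH have \<phi>p: "\<phi> p = p" by blast
    then have p': "is_addr p t'" using bij_betwE[OF bij] p vT vU by force
    obtain k l where k: "{i. is_addr (p @ [i]) t} = {..<k}" and l: "{i. is_addr (p @ [i]) t'} = {..<l}"
      using interval by metis
    have chT: "children ?T p = (\<lambda>i. p @ [i]) ` {..<k}"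
      using children_planar_tree_of[OF p] by (auto simp flip: k)
    have chU: "children ?U p = (\<lambda>i. p @ [i]) ` {..<l}"
      using children_planar_tree_of[OF p'] by (auto simp flip: l)
    define f where "f = (\<lambda>j. last (\<phi> (p @ [j])))"
    have image: "\<phi> ` children ?T p = children ?U p"
    proof
      show "\<phi> ` children ?T p \<subseteq> children ?U p"
        using tree_iso_children[OF iso, of p] p vT \<phi>p by auto
      show "children ?U p \<subseteq> \<phi> ` children ?T p"
      proof
        fix a assume a: "a \<in> children ?U p"
        let ?g = "inv_into (verts ?T) \<phi>"
        have "?g p = p" using bij p vT \<phi>p by (metis bij_betw_inv_into_left mem_Collect_eq)
        then have "?g a \<in> children ?T p"
          using tree_iso_children[OF tree_iso_inv[OF iso], of p a] a p' vT vU by simp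
        moreover have "\<phi> (?g a) = a"
          using bij a by (auto simp: bij_betw_inv_into_right children_def)
        ultimately show "a \<in> \<phi> ` children ?T p" by (metis imageI)
      qed
    qed
    have f: "\<phi> (p @ [j]) = p @ [f j]" if "j < k" for j
    proof -
      have "\<phi> (p @ [j]) \<in> children ?U p" using image chT that by blast
      then show ?thesis unfolding chU f_def by auto
    qed
    have "f ` {..<k} = {..<l}"
    proof -
      have "(\<lambda>i. p @ [i]) ` f ` {..<k} = (\<lambda>i. p @ [i]) ` {..<l}"
        using image f unfolding chT chU by (simp add: image_image)
      then show ?thesis by (subst (asm) inj_image_eq_iff) (auto simp: inj_def)
    qed
    moreover have "inj_on f {..<k}"
    proof (rule inj_onI)
      fix i j assume ij: "i \<in> {..<k}" "j \<in> {..<k}" "f i = f j"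
      then have "\<phi> (p @ [i]) = \<phi> (p @ [j])" using f by simp
      moreover have "p @ [i] \<in> verts ?T" "p @ [j] \<in> verts ?T" using ij k vT by blast+
      ultimately show "i = j" using bij by (auto simp: bij_betw_def dest: inj_onD)
    qed
    ultimately have "bij_betw f {..<k} {..<l}" by (simp add: bij_betw_def)
    moreover have "f i < f j" if "i < j" "j < k" for i j
    proof -
      have "before ?U (\<phi> (p @ [i])) (\<phi> (p @ [j])) \<longleftrightarrow> before ?T (p @ [i]) (p @ [j])"
        using ord p vT that unfolding keeps_order_def chT[symmetric]
        by (metis (no_types, lifting) chT imageI lessThan_iff less_trans mem_Collect_eq)
      then show ?thesis using f that by (auto simp: planar_tree_of_def)
    qed
    moreover have "i < k" using snoc.prems k by blast
    ultimately have "f i = i" by (rule strict_mono_bij_lessThan)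
    then show ?case using f[OF \<open>i < k\<close>] by simp
  qed
  have "\<phi> ` {p. is_addr p t} = {p. is_addr p t'}" using bij vT vU by (simp add: bij_betw_def)
  moreover have "\<phi> ` {p. is_addr p t} = {p. is_addr p t}" using fix_points by simp
  ultimately show ?thesis by (intro addresses_inject) simp
qed


section \<open>Recursive contraction\<close>

definition branch_part :: "'a \<Rightarrow> 'a list set \<Rightarrow> 'a list set" where
  "branch_part i I = {p. i # p \<in> I}"

lemma ancestors_Nil [simp]: "[] \<in> ancestors I \<longleftrightarrow> I \<noteq> {}"
  by (auto simp: ancestors_def)

lemma ancestors_Cons [simp]: "i # p \<in> ancestors I \<longleftrightarrow> p \<in> ancestors (branch_part i I)"
proof
  assume "i # p \<in> ancestors I"
  then obtain a where a: "a \<in> I" "prefix (i # p) a" unfolding ancestors_def by blast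
  then obtain q where "a = i # q" "prefix p q" by (cases a) auto
  with a show "p \<in> ancestors (branch_part i I)" by (auto simp: ancestors_def branch_part_def)
next
  assume "p \<in> ancestors (branch_part i I)"
  then obtain q where "i # q \<in> I" "prefix p q" by (auto simp: ancestors_def branch_part_def)
  then show "i # p \<in> ancestors I" unfolding ancestors_def by (intro CollectI bexI[of _ "i # q"]) auto
qed

lemma unary_free_ancestors_empty [simp]: "unary_free (ancestors {}) = {}"
  by (simp add: unary_free_def ancestors_def)

lemma unary_free_Cons [simp]:
  "i # p \<in> unary_free (ancestors I) \<longleftrightarrow> p \<in> unary_free (ancestors (branch_part i I))"
  by (simp add: unary_free_def)

lemma unary_free_Nil [simp]:
  "[] \<in> unary_free (ancestors I) \<longleftrightarrow> I \<noteq> {} \<and> card {i. branch_part i I \<noteq> {}} \<noteq> 1"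
  by (simp add: unary_free_def)

lemma size_nth_termination [termination_simp]:
  "i < length ts \<Longrightarrow> size (ts ! i) < Suc (size_list size ts)"
  using size_list_estimation'[of "ts ! i" ts "size (ts ! i)" size] by (simp add: less_Suc_eq_le)

text \<open>An empty list \<open>us\<close> gives \<open>Node []\<close>. This is right when the
  root itself is the selected vertex and a mere default for \<open>I = {}\<close>, so results that
  interpret \<open>contract\<close> as a contraction assume a nonempty \<open>I\<close>.\<close>

fun contract :: "ptree \<Rightarrow> nat list set \<Rightarrow> ptree" where
  "contract (Node ts) I =
     (let us = map (\<lambda>i. contract (ts ! i) (branch_part i I))
                 (filter (\<lambda>i. branch_part i I \<noteq> {}) [0..<length ts])
      in if length us = 1 then hd us else Node us)"

definition order_iso :: "(nat list \<Rightarrow> nat list) \<Rightarrow> nat list set \<Rightarrow> nat list set \<Rightarrow> bool" where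
  "order_iso \<phi> A B \<longleftrightarrow> bij_betw \<phi> A B \<and>
     (\<forall>a\<in>A. \<forall>b\<in>A. (prefix (\<phi> a) (\<phi> b) \<longleftrightarrow> prefix a b) \<and> (left_of (\<phi> a) (\<phi> b) \<longleftrightarrow> left_of a b))"

lemma order_iso_covers:
  assumes "order_iso \<phi> A B" "a \<in> A" "b \<in> A"
  shows "covers B (\<phi> a) (\<phi> b) \<longleftrightarrow> covers A a b"
proof -
  have B: "B = \<phi> ` A" "inj_on \<phi> A" using assms(1) by (auto simp: order_iso_def bij_betw_def)
  have strict: "strict_prefix (\<phi> x) (\<phi> y) \<longleftrightarrow> strict_prefix x y" if "x \<in> A" "y \<in> A" for x y
    using assms(1) that B(2) unfolding order_iso_def strict_prefix_def by (metis inj_onD)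
  show ?thesis using assms(2,3) strict by (auto simp: covers_def B(1))
qed

text \<open>Roots are least elements and edges are covering pairs, so both are preserved with the
  prefix order. \<open>before U\<close> is compared with \<open>left_of\<close> on siblings only,
  since in an address tree it is false on other pairs.\<close>

lemma order_iso_isomorphic:
  assumes T: "hasse_tree T A" and U: "hasse_tree U B" and iso: "order_iso \<phi> A B"
    and "\<And>a b. a \<in> A \<Longrightarrow> b \<in> A \<Longrightarrow> before T a b \<longleftrightarrow> left_of a b"
    and "\<And>u a b. a \<in> children U u \<Longrightarrow> b \<in> children U u \<Longrightarrow> u \<in> B \<Longrightarrow> before U a b \<longleftrightarrow> left_of a b"
  shows "isomorphic T U"
proof -
  interpret T: hasse_tree T A by fact
  interpret U: hasse_tree U B by fact
  have bij: "bij_betw \<phi> A B" using iso by (simp add: order_iso_def)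
  have pre: "prefix (\<phi> a) (\<phi> b) \<longleftrightarrow> prefix a b" "left_of (\<phi> a) (\<phi> b) \<longleftrightarrow> left_of a b"
    if "a \<in> A" "b \<in> A" for a b
    using iso that by (simp_all add: order_iso_def)
  obtain r where r: "r \<in> A" "\<phi> r = root U" using bij U.root_in by (metis bij_betw_iff_bijections)
  have "prefix (\<phi> (root T)) (root U)" using pre T.root_in T.root_least r by metis
  moreover have "\<phi> (root T) \<in> B" using bij T.root_in bij_betwE by blast
  ultimately have "\<phi> (root T) = root U" using U.root_least by (simp add: prefix_order.antisym)
  then have i: "tree_iso \<phi> T U"
    using bij order_iso_covers[OF iso]
    by (simp add: tree_iso_def T.verts U.verts T.edge_iff U.edge_iff)
  have "keeps_order \<phi> T U" unfolding keeps_order_def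
  proof (intro ballI)
    fix u a b assume *: "u \<in> verts T" "a \<in> children T u" "b \<in> children T u"
    have "\<phi> a \<in> children U (\<phi> u)" "\<phi> b \<in> children U (\<phi> u)" "\<phi> u \<in> B"
      using tree_iso_children[OF i] * bij_betwE[OF bij] T.verts by auto
    moreover have "a \<in> A" "b \<in> A" using * by (simp_all add: children_def T.verts)
    ultimately show "before U (\<phi> a) (\<phi> b) \<longleftrightarrow> before T a b" using assms(4,5) pre by simp
  qed
  with i show ?thesis unfolding isomorphic_iff by blast
qed

lemma order_iso_inv:
  assumes "order_iso \<psi> B A"
  shows "order_iso (inv_into B \<psi>) A B"
proof -
  have bij: "bij_betw \<psi> B A" using assms by (simp add: order_iso_def)
  have "inv_into B \<psi> a \<in> B" "\<psi> (inv_into B \<psi> a) = a" if "a \<in> A" for a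
    using bij that by (simp_all add: bij_betw_inv_into_right bij_betw_def inv_into_into)
  then show ?thesis
    using assms bij_betw_inv_into[OF bij] unfolding order_iso_def by metis
qed

text \<open>The map leads from the contracted tree back to the original addresses, because the
  recursion defines it in this direction: entries are renumbered and skipped unary vertices are
  reinserted.\<close>

lemma contract_order_iso:
  "I \<subseteq> {p. is_addr p t} \<Longrightarrow> I \<noteq> {} \<Longrightarrow>
     \<exists>\<psi>. order_iso \<psi> {p. is_addr p (contract t I)} (unary_free (ancestors I))"
proof (induction t arbitrary: I)
  case (Node ts)
  let ?B = "\<lambda>i. branch_part i I" and ?W = "unary_free (ancestors I)"
  define J where "J = filter (\<lambda>i. ?B i \<noteq> {}) [0..<length ts]"
  define us where "us = map (\<lambda>i. contract (ts ! i) (?B i)) J"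
  have "?B i \<subseteq> {p. is_addr p (ts ! i)} \<and> (?B i \<noteq> {} \<longrightarrow> i < length ts)" for i
    using Node.prems(1) by (auto simp: branch_part_def)
  then have J: "set J = {i. ?B i \<noteq> {}}" and sub: "\<And>i. ?B i \<subseteq> {p. is_addr p (ts ! i)}"
    by (auto simp: J_def)
  have J_lt: "i < length ts" if "i \<in> set J" for i using that by (auto simp: J_def)
  have sorted: "sorted_wrt (<) J" by (simp add: J_def sorted_wrt_filter)
  have J_mono: "J ! i < J ! j \<longleftrightarrow> i < j" if "i < length J" "j < length J" for i j
    using sorted_wrt_nth_less[OF sorted, of i j] sorted_wrt_nth_less[OF sorted, of j i] that
    by (metis less_asym linorder_neqE_nat)
  have J_inj: "J ! i = J ! j \<longleftrightarrow> i = j" if "i < length J" "j < length J" for i j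
    using J_mono that by (metis less_irrefl linorder_neqE_nat)
  have "\<forall>i\<in>set J. \<exists>\<psi>. order_iso \<psi> {p. is_addr p (contract (ts ! i) (?B i))} (unary_free (ancestors (?B i)))"
    using Node.IH[OF nth_mem[OF J_lt] sub] J by blast
  then obtain f where f: "\<And>i. i \<in> set J \<Longrightarrow>
      order_iso (f i) {p. is_addr p (contract (ts ! i) (?B i))} (unary_free (ancestors (?B i)))"
    by metis
  have card: "card {i. ?B i \<noteq> {}} = length J"
    using sorted by (simp flip: J add: distinct_card strict_sorted_iff)
  have W_Cons: "i # p \<in> ?W \<longleftrightarrow> i \<in> set J \<and> p \<in> unary_free (ancestors (?B i))" for i p
    by (cases "?B i = {}") (auto simp: J)
  have contract: "contract (Node ts) I = (if length J = 1 then hd us else Node us)"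
    by (simp add: us_def J_def Let_def)
  show ?case
  proof (cases "length J = 1")
    \<comment> \<open>Only branch \<open>i\<close> meets \<open>I\<close>. The root has arity 1 in
      the spanned tree and disappears, so \<open>i\<close> is put in front of the images from that
      branch.\<close>
    case True
    then obtain i where i: "J = [i]" by (auto simp: length_Suc_conv)
    let ?A = "{p. is_addr p (contract (ts ! i) (?B i))}"
    have fi: "order_iso (f i) ?A (unary_free (ancestors (?B i)))" using f i by simp
    have "w \<in> ?W \<longleftrightarrow> w \<in> (#) i ` unary_free (ancestors (?B i))" for w
      using i card True by (cases w) (auto simp: W_Cons simp del: unary_free_Cons)
    then have W: "?W = (#) i ` unary_free (ancestors (?B i))" by blast
    have "order_iso ((#) i \<circ> f i) ?A ?W"
      using fi unfolding W order_iso_def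
      by (auto simp: left_of_Cons intro!: bij_betw_trans[of "f i" _ _ "(#) i"] inj_on_imp_bij_betw)
    moreover have "contract (Node ts) I = contract (ts ! i) (?B i)"
      using contract i by (simp add: us_def)
    ultimately show ?thesis by auto
  next
    case False
    \<comment> \<open>The root survives, and child \<open>k\<close> of the contraction comes from
      the branch \<open>J ! k\<close>. This includes \<open>J = []\<close>, where only the root is
      selected.\<close>
    define \<psi> where "\<psi> p = (case p of [] \<Rightarrow> [] | k # q \<Rightarrow> J ! k # f (J ! k) q)" for p
    let ?A = "{p. is_addr p (Node us)}"
    have A_Cons: "k # q \<in> ?A \<longleftrightarrow>
        k < length J \<and> q \<in> {p. is_addr p (contract (ts ! (J ! k)) (?B (J ! k)))}" for k q
      by (auto simp: us_def)
    have \<psi>: "\<psi> [] = []" "\<psi> (k # q) = J ! k # f (J ! k) q" for k q by (simp_all add: \<psi>_def)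
    have fk: "order_iso (f (J ! k)) {p. is_addr p (contract (ts ! (J ! k)) (?B (J ! k)))}
        (unary_free (ancestors (?B (J ! k))))" if "k < length J" for k
      using f that by simp
    have W_Nil: "[] \<in> ?W" using False Node.prems(2) card by simp
    have orders: "(prefix (\<psi> a) (\<psi> b) \<longleftrightarrow> prefix a b) \<and> (left_of (\<psi> a) (\<psi> b) \<longleftrightarrow> left_of a b)"
      if "a \<in> ?A" "b \<in> ?A" for a b
    proof (cases a; cases b)
      fix k q l r assume ab: "a = k # q" "b = l # r"
      with that have kl: "k < length J" "l < length J" by (simp_all add: us_def)
      show ?thesis
      proof (cases "k = l")
        case True
        then show ?thesis
          using fk[OF kl(1)] that unfolding ab A_Cons by (simp add: order_iso_def \<psi> left_of_Cons)
      next
        case False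
        then show ?thesis using J_mono[OF kl] J_inj[OF kl] by (simp add: ab \<psi> left_of_Cons)
      qed
    qed (auto simp: \<psi>)
    \<comment> \<open>Equal images are prefixes of each other, so reflecting the prefix order
      already forces injectivity by antisymmetry.\<close>
    have "inj_on \<psi> ?A"
      by (rule inj_onI) (metis orders prefix_order.antisym prefix_order.order_refl)
    moreover have "\<psi> ` ?A = ?W"
    proof (intro equalityI subsetI)
      fix w assume "w \<in> \<psi> ` ?A"
      then obtain a where a: "a \<in> ?A" "w = \<psi> a" by blast
      show "w \<in> ?W"
      proof (cases a)
        case (Cons k q)
        with a(1) have kq: "k < length J" "q \<in> {p. is_addr p (contract (ts ! (J ! k)) (?B (J ! k)))}"
          using A_Cons by blast+
        then have "f (J ! k) q \<in> unary_free (ancestors (?B (J ! k)))"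
          using fk[OF kq(1)] unfolding order_iso_def by (metis bij_betwE)
        then show ?thesis using kq(1) by (simp only: a(2) Cons \<psi> W_Cons) simp
      qed (use W_Nil a \<psi> in simp)
    next
      fix w assume w: "w \<in> ?W"
      show "w \<in> \<psi> ` ?A"
      proof (cases w)
        case Nil
        then show ?thesis using \<psi>(1) by (intro image_eqI[of _ _ "[]"]) auto
      next
        case (Cons i p)
        with w have "i \<in> set J" "p \<in> unary_free (ancestors (?B i))" using W_Cons by blast+
        then obtain k where k: "k < length J" "i = J ! k" by (metis in_set_conv_nth)
        have "f (J ! k) ` {p. is_addr p (contract (ts ! (J ! k)) (?B (J ! k)))} =
            unary_free (ancestors (?B (J ! k)))"
          using fk[OF k(1)] by (simp add: order_iso_def bij_betw_def)
        then have "p \<in> f (J ! k) ` {p. is_addr p (contract (ts ! (J ! k)) (?B (J ! k)))}"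
          using \<open>p \<in> _\<close> k(2) by simp
        then obtain q where q: "q \<in> {p. is_addr p (contract (ts ! (J ! k)) (?B (J ! k)))}"
            "f (J ! k) q = p"
          by (elim imageE) simp
        then have "k # q \<in> ?A" using A_Cons k(1) by blast
        moreover have "\<psi> (k # q) = w" by (simp add: \<psi> Cons k(2) q(2))
        ultimately show ?thesis by (metis imageI)
      qed
    qed
    ultimately have "order_iso \<psi> ?A ?W"
      using orders by (simp add: order_iso_def bij_betw_def)
    moreover have "contract (Node ts) I = Node us" using contract False by simp
    ultimately show ?thesis by auto
  qed
qed

lemma reduced_contract: "reduced t \<Longrightarrow> reduced (contract t I)"
proof (induction t arbitrary: I)
  case (Node ts)
  define us where "us = map (\<lambda>i. contract (ts ! i) (branch_part i I))
    (filter (\<lambda>i. branch_part i I \<noteq> {}) [0..<length ts])"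
  have us: "\<forall>u\<in>set us. reduced u" using Node by (auto simp: us_def)
  have contract: "contract (Node ts) I = (if length us = 1 then hd us else Node us)"
    by (simp add: us_def Let_def)
  show ?case
  proof (cases "length us = 1")
    case True
    then have "hd us \<in> set us" by (intro hd_in_set) auto
    with True us contract show ?thesis by (simp del: contract.simps)
  qed (use us contract in \<open>simp del: contract.simps\<close>)
qed

lemma isomorphic_contract:
  assumes "I \<subseteq> {p. is_addr p t}" "I \<noteq> {}"
  shows "isomorphic (Red (span_tree (planar_tree_of t) I)) (planar_tree_of (contract t I))"
    and "root (Red (span_tree (planar_tree_of t) I)) \<in> verts (Red (span_tree (planar_tree_of t) I))"
proof -
  let ?A = "ancestors I" and ?R = "Red (span_tree (planar_tree_of t) I)"
  have fin: "finite ?A"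
    using ancestors_addresses[OF assms(1)] finite_addresses finite_subset by blast
  have bef: "before (span_tree (planar_tree_of t) I) =
      (\<lambda>p q. \<exists>u i j. p = u @ [i] \<and> q = u @ [j] \<and> i < j)"
    by (simp add: span_tree_def planar_tree_of_def)
  note red = hasse_tree_Red[OF hasse_tree_span_tree[OF assms] prefix_closed_ancestors fin bef]
    before_Red[OF hasse_tree_span_tree[OF assms] prefix_closed_ancestors fin bef]
  from contract_order_iso[OF assms] obtain \<psi>
    where "order_iso \<psi> {p. is_addr p (contract t I)} (unary_free ?A)" by blast
  note iso = order_iso_inv[OF this]
  show "isomorphic ?R (planar_tree_of (contract t I))"
  proof (rule order_iso_isomorphic[OF red(1) hasse_tree_planar_tree_of iso red(2)])
    fix u a b assume "u \<in> {p. is_addr p (contract t I)}"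
      and "a \<in> children (planar_tree_of (contract t I)) u"
      and "b \<in> children (planar_tree_of (contract t I)) u"
    then obtain i j where "a = u @ [i]" "b = u @ [j]" by (auto simp: children_planar_tree_of)
    then show "before (planar_tree_of (contract t I)) a b \<longleftrightarrow> left_of a b"
      by (simp add: planar_tree_of_def left_of_siblings)
  qed
  interpret R: hasse_tree ?R "unary_free ?A" by (rule red(1))
  show "root ?R \<in> verts ?R" using R.root_in R.verts by simp
qed

text \<open>The definite description is evaluated here: \<open>isomorphic_contract\<close> gives a
  solution, and rigidity of address trees gives uniqueness.\<close>

lemma contraction_eq_contract:
  assumes I: "I \<subseteq> Leaves (Some V)" and ne: "I \<noteq> {}"
  shows "contraction (Some V) I = Some (Abs_prt (contract (Rep_prt V) I))"
proof -
  let ?X = "Red (span_tree (planar_tree_of (Rep_prt V)) I)"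
  and ?c = "contract (Rep_prt V) I"
  have "reduced ?c" using Rep_prt[of V] by (intro reduced_contract) simp
  then have c: "Rep_prt (Abs_prt ?c) = ?c" by (simp add: Abs_prt_inverse)
  have addr: "I \<subseteq> {p. is_addr p (Rep_prt V)}" using I by (auto simp: leaves_planar_tree_of)
  note iso = isomorphic_contract[OF addr ne]
  have "(THE R. isomorphic ?X (planar_tree_of (Rep_prt R))) = Abs_prt ?c"
  proof (rule the_equality)
    fix R assume "isomorphic ?X (planar_tree_of (Rep_prt R))"
    then have "isomorphic (planar_tree_of (Rep_prt R)) (planar_tree_of ?c)"
      using isomorphic_sym[OF _ iso(2)] isomorphic_trans iso(1) by blast
    then show "R = Abs_prt ?c"
      using isomorphic_planar_tree_ofD by (metis Rep_prt_inverse)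
  qed (use iso(1) c in simp)
  with ne show ?thesis by simp
qed


section \<open>Contractions of grafted trees and the shuffle product\<close>

lemma leaves_planar_tree_of_Cons [simp]:
  "i # p \<in> leaves (planar_tree_of t) \<longleftrightarrow>
     i < length (branches t) \<and> p \<in> leaves (planar_tree_of (branches t ! i))"
  by (auto simp: leaves_planar_tree_of)

lemma leaves_planar_tree_of_Nil [simp]:
  "[] \<in> leaves (planar_tree_of t) \<longleftrightarrow> branches t = []"
  by (auto simp: leaves_planar_tree_of)

lemma leaves_planar_tree_of_nonempty: "leaves (planar_tree_of t) \<noteq> {}"
proof (induction t)
  case (Node ts)
  show ?case
  proof (cases "ts = []")
    case True
    then have "[] \<in> leaves (planar_tree_of (Node ts))" by simp
    then show ?thesis by blast
  next
    case False
    then obtain p where "p \<in> leaves (planar_tree_of (ts ! 0))" using Node by force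
    then have "0 # p \<in> leaves (planar_tree_of (Node ts))" using False by simp
    then show ?thesis by blast
  qed
qed

lemma finite_Leaves: "finite (Leaves V)"
  by (cases V) (auto simp: leaves_planar_tree_of intro: finite_subset[OF _ finite_addresses])

text \<open>Every branch contains a leaf, so none is dropped, and a reduced root never has a single
  branch into which it could collapse.\<close>

lemma contract_leaves: "reduced t \<Longrightarrow> contract t (leaves (planar_tree_of t)) = t"
proof (induction t)
  case (Node ts)
  have part: "branch_part i (leaves (planar_tree_of (Node ts))) = leaves (planar_tree_of (ts ! i))"
    if "i < length ts" for i
    using that by (auto simp: branch_part_def)
  have "filter (\<lambda>i. branch_part i (leaves (planar_tree_of (Node ts))) \<noteq> {}) [0..<length ts] = [0..<length ts]"
    using leaves_planar_tree_of_nonempty by (auto simp: part)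
  moreover have "map (\<lambda>i. contract (ts ! i) (branch_part i (leaves (planar_tree_of (Node ts))))) [0..<length ts] = ts"
    using Node by (intro nth_equalityI) (auto simp: part)
  ultimately show ?case using Node.prems by (simp add: Let_def)
qed

lemma Leaves_nonempty: "Leaves (Some V) \<noteq> {}"
  by (simp add: leaves_planar_tree_of_nonempty)

lemma contraction_Leaves: "contraction (Some V) (Leaves (Some V)) = Some V"
  using Rep_prt[of V]
  by (subst contraction_eq_contract) (auto simp: leaves_planar_tree_of_nonempty contract_leaves Rep_prt_inverse)

lemma contraction_eq_None_iff [simp]: "contraction (Some V) I = None \<longleftrightarrow> I = {}"
  by simp

lemma contraction_empty [simp]: "contraction V {} = None"
  by (cases V) auto

declare contraction.simps(2) [simp del]

lemma mem_N_set:
  "I \<in> N_set S T V \<longleftrightarrow> I \<subseteq> Leaves V \<and> contraction V I = S \<and> contraction V (Leaves V - I) = T"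
  by (simp add: N_set_def)

section \<open>Grafting, decomposition and the contraction of a grafted tree\<close>

lemma Rep_x_tree [simp]: "Rep_prt x_tree = Node []"
  by (simp add: x_tree_def Abs_prt_inverse)

text \<open>For a list of length 1 the node would not be reduced, and \<open>Abs_prt\<close> of it
  is unspecified.\<close>

lemma Rep_graft: "length Vs \<noteq> 1 \<Longrightarrow> Rep_prt (graft Vs) = Node (map Rep_prt Vs)"
  using Rep_prt by (auto simp: graft_def intro!: Abs_prt_inverse)

lemma graft_eq_iff: "length Vs \<noteq> 1 \<Longrightarrow> length Ws \<noteq> 1 \<Longrightarrow> graft Vs = graft Ws \<longleftrightarrow> Vs = Ws"
proof
  assume l: "length Vs \<noteq> 1" "length Ws \<noteq> 1" and "graft Vs = graft Ws"
  then have "map Rep_prt Vs = map Rep_prt Ws" using Rep_graft[OF l(1)] Rep_graft[OF l(2)] by simp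
  moreover have "inj Rep_prt" by (simp add: inj_def Rep_prt_inject)
  ultimately show "Vs = Ws" by simp
qed simp

lemma graft_neq_x_tree: "length Vs \<ge> 2 \<Longrightarrow> graft Vs \<noteq> x_tree"
proof
  assume "length Vs \<ge> 2" "graft Vs = x_tree"
  then have "Node (map Rep_prt Vs) = Node []" using Rep_graft[of Vs] by simp
  with \<open>length Vs \<ge> 2\<close> show False by simp
qed

lemma prt_cases:
  obtains "V = x_tree" | Vs where "length Vs \<ge> 2" "V = graft Vs"
proof (cases "Rep_prt V")
  case (Node ts)
  then have r: "length ts \<noteq> 1" "\<forall>t\<in>set ts. reduced t" using Rep_prt[of V] by auto
  then have ts: "map Rep_prt (map Abs_prt ts) = ts" by (simp add: Abs_prt_inverse map_idI)
  show thesis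
  proof (cases "ts = []")
    case True
    then show ?thesis using that(1) Node by (metis Rep_prt_inverse x_tree_def)
  next
    case False
    then have "length ts \<ge> 2" using r(1) by (cases ts) (auto simp: Suc_le_eq)
    moreover have "V = graft (map Abs_prt ts)"
      using Node ts by (metis Rep_prt_inverse graft_def)
    ultimately show ?thesis using that(2)[of "map Abs_prt ts"] by simp
  qed
qed

lemma Leaves_graft_Cons [simp]:
  "length Vs \<noteq> 1 \<Longrightarrow> i # p \<in> Leaves (Some (graft Vs)) \<longleftrightarrow> i < length Vs \<and> p \<in> Leaves (Some (Vs ! i))"
  by (auto simp: Rep_graft)

lemma Leaves_graft_Nil [simp]: "length Vs \<ge> 2 \<Longrightarrow> [] \<notin> Leaves (Some (graft Vs))"
  by (auto simp: Rep_graft)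

declare Leaves.simps(2) [simp del]

lemma decomposition_cases:
  assumes "decomposition S Ss"
  obtains "S = x_tree" "Ss = [x_tree]" | "length Ss \<ge> 2" "S = graft Ss"
proof (cases "S = x_tree")
  case False
  then have l: "length Ss = root_arity S" and S: "S = graft Ss" using assms by (auto simp: decomposition_def)
  obtain Vs where "length Vs \<ge> 2" "S = graft Vs" using prt_cases[of S] False by blast
  then have "length Ss \<ge> 2" using l Rep_graft[of Vs] by (simp add: root_arity_def)
  with S that show thesis by blast
qed (use assms that in \<open>auto simp: decomposition_def\<close>)

text \<open>Only \<open>x\<close> has a decomposition of length 1. Hence the two candidate lists
  \<open>[S]\<close> and \<open>Ss\<close> never compete at the same length.\<close>

lemma decomposition_length_1: "decomposition S Ss \<Longrightarrow> length Ss = 1 \<Longrightarrow> Ss = [S]"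
  by (auto elim!: decomposition_cases)

definition contraction_parts :: "prt list \<Rightarrow> nat list set \<Rightarrow> prt list" where
  "contraction_parts Vs I = map the (filter (\<lambda>s. s \<noteq> None)
     (map (\<lambda>i. contraction (Some (Vs ! i)) (branch_part i I)) [0..<length Vs]))"

text \<open>If one branch meets \<open>I\<close>, its contraction is the whole result and must be
  \<open>S\<close>; if several do, the result is their grafting and injectivity of
  \<open>graft\<close> yields \<open>Ss\<close>. A list of several parts cannot produce
  \<open>x\<close>.\<close>

lemma contraction_graft_eq_iff:
  assumes Vs: "length Vs \<ge> 2" and I: "I \<subseteq> Leaves (Some (graft Vs))" and S: "decomposition S Ss"
  shows "contraction (Some (graft Vs)) I = Some S \<longleftrightarrow> contraction_parts Vs I \<in> {[S], Ss}"
proof (cases "I = {}")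
  case True
  then have "contraction_parts Vs I = []"
    by (auto simp: contraction_parts_def branch_part_def filter_empty_conv)
  then show ?thesis using True S by (auto elim: decomposition_cases)
next
  case False
  define J where "J = filter (\<lambda>i. branch_part i I \<noteq> {}) [0..<length Vs]"
  define us where "us = map (\<lambda>i. contract (Rep_prt (Vs ! i)) (branch_part i I)) J"
  have sub: "branch_part i I \<subseteq> Leaves (Some (Vs ! i))" if "i < length Vs" for i
    using I Vs that by (auto simp: branch_part_def)
  have "contraction_parts Vs I = map (\<lambda>i. the (contraction (Some (Vs ! i)) (branch_part i I))) J"
    by (simp only: contraction_parts_def J_def filter_map map_map o_def contraction_eq_None_iff)
  also have "\<dots> = map Abs_prt us"
    unfolding us_def map_map
  proof (rule map_cong)
    fix i assume "i \<in> set J"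
    then have "i < length Vs" "branch_part i I \<noteq> {}" by (auto simp: J_def)
    then show "the (contraction (Some (Vs ! i)) (branch_part i I)) =
        (Abs_prt \<circ> (\<lambda>i. contract (Rep_prt (Vs ! i)) (branch_part i I))) i"
      using contraction_eq_contract[OF sub] by simp
  qed simp
  finally have parts: "contraction_parts Vs I = map Abs_prt us" .
  have "\<forall>u\<in>set us. reduced u"
    using Rep_prt reduced_contract by (auto simp: us_def)
  then have us: "map Rep_prt (map Abs_prt us) = us" by (simp add: Abs_prt_inverse map_idI)
  obtain a where a: "a \<in> I" using False by blast
  then obtain i p where "a = i # p" "i < length Vs"
    using I Vs by (cases a) auto
  with a have "i \<in> set J" by (auto simp: J_def branch_part_def)
  then have ne: "us \<noteq> []" by (auto simp: us_def)
  have "us = map (\<lambda>i. contract (map Rep_prt Vs ! i) (branch_part i I))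
      (filter (\<lambda>i. branch_part i I \<noteq> {}) [0..<length (map Rep_prt Vs)])"
    by (auto simp: us_def J_def)
  then have "contract (Rep_prt (graft Vs)) I = (if length us = 1 then hd us else Node us)"
    using Vs by (simp add: Rep_graft Let_def)
  then have c: "contraction (Some (graft Vs)) I = Some (Abs_prt (if length us = 1 then hd us else Node us))"
    using contraction_eq_contract[OF I False] by simp
  show ?thesis
  proof (cases "length us = 1")
    case True
    then obtain u where "us = [u]" by (auto simp: length_Suc_conv)
    then show ?thesis using c parts decomposition_length_1[OF S] by auto
  next
    case False
    then have len: "length us \<ge> 2" using ne by (cases us) (auto simp: Suc_le_eq)
    have "Abs_prt (Node us) = graft (map Abs_prt us)" by (simp only: graft_def us)
    then have c': "contraction (Some (graft Vs)) I = Some (graft (map Abs_prt us))"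
      using c False by simp
    from S show ?thesis
    proof (cases rule: decomposition_cases)
      case 1
      then show ?thesis using c' len parts graft_neq_x_tree[of "map Abs_prt us"] by auto
    next
      case 2
      then show ?thesis using c' len parts graft_eq_iff[of "map Abs_prt us" Ss] by auto
    qed
  qed
qed

section \<open>Symmetry of the shuffle product and its values in small cases\<close>

lemma N_set_commute:
  "N_set T S V = (\<lambda>I. Leaves V - I) ` N_set S T V"
proof -
  have mem: "Leaves V - I \<in> N_set T S V" if "I \<in> N_set S T V" for I S T
    using that by (auto simp: N_set_def double_diff)
  have "I \<in> (\<lambda>I. Leaves V - I) ` N_set S T V" if I: "I \<in> N_set T S V" for I
  proof
    show "I = Leaves V - (Leaves V - I)" using I by (auto simp: N_set_def)
  qed (rule mem[OF I])
  then show ?thesis using mem by blast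
qed

lemma card_N_set_commute: "card (N_set T S V) = card (N_set S T V)"
proof -
  have "inj_on (\<lambda>I. Leaves V - I) (N_set S T V)"
    by (rule inj_onI) (auto simp: N_set_def)
  then show ?thesis by (metis N_set_commute card_image)
qed

lemma shuffle_commute: "shuffle S T = shuffle T S"
proof -
  have "N_set T S V = {} \<longleftrightarrow> N_set S T V = {}" for V
    by (metis N_set_commute image_is_empty)
  then show ?thesis by (simp add: shuffle_def card_N_set_commute[of T S])
qed

text \<open>The empty tree is neutral for the shuffle product. This describes a branch of V occupied
  by one of the two trees only.\<close>

lemma N_set_None_left: "N_set None (Some T) (Some V) = (if V = T then {{}} else {})"
  unfolding N_set_def using contraction_Leaves[of V] by (auto)

lemma N_set_None_right: "N_set (Some S) None (Some V) = (if V = S then {Leaves (Some V)} else {})"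
proof -
  have "N_set (Some S) None (Some V) = {I. I = Leaves (Some V) \<and> contraction (Some V) I = Some S}"
    unfolding N_set_def by (auto)
  then show ?thesis using contraction_Leaves[of V] by (auto)
qed

lemma N_set_empty_tree: "N_set (Some S) T None = {}"
  by (simp add: N_set_def)

text \<open>A single leaf cannot be shared out between two nonempty sets.\<close>

lemma N_set_x_tree: "N_set (Some S) (Some T) (Some x_tree) = {}"
proof -
  have "p \<in> Leaves (Some x_tree) \<longleftrightarrow> p = []" for p
    by (cases p) (simp_all add: Leaves.simps(2))
  then have "Leaves (Some x_tree) = {[]}" by auto
  then have "I = {} \<or> Leaves (Some x_tree) - I = {}" if "I \<subseteq> Leaves (Some x_tree)" for I
    using that by auto
  then have "I \<notin> N_set (Some S) (Some T) (Some x_tree)" for I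
    unfolding mem_N_set by (metis contraction_empty option.distinct(1))
  then show ?thesis by blast
qed

section \<open>Finite support of the shuffle product\<close>

lemma card_le_card_addresses:
  assumes "I \<subseteq> Leaves (Some V)" "contraction (Some V) I = Some S"
  shows "card I \<le> card {p. is_addr p (Rep_prt S)}"
proof -
  have I: "I \<noteq> {}" using assms(2) by auto
  have leaf: "I \<subseteq> {p. is_addr p (Rep_prt V)}" "\<And>p i. p \<in> I \<Longrightarrow> \<not> is_addr (p @ [i]) (Rep_prt V)"
    using assms(1) by (auto simp: Leaves.simps(2) leaves_planar_tree_of)
  have "reduced (contract (Rep_prt V) I)" using Rep_prt[of V] by (intro reduced_contract) simp
  then have S: "Rep_prt S = contract (Rep_prt V) I"
    using assms(2) contraction_eq_contract[OF assms(1) I] by (auto simp: Abs_prt_inverse)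
  obtain \<psi> where \<psi>: "bij_betw \<psi> {p. is_addr p (Rep_prt S)} (unary_free (ancestors I))"
    using contract_order_iso[OF leaf(1) I] unfolding S order_iso_def by blast
  \<comment> \<open>Selected leaves have no descendants in the spanned tree and so survive the
    reduction. The number of all vertices of \<open>S\<close> bounds them, a crude bound that is
    enough for finiteness.\<close>
  have "I \<subseteq> unary_free (ancestors I)"
  proof
    fix p assume p: "p \<in> I"
    then have "{i. p @ [i] \<in> ancestors I} = {}"
      using leaf(2) ancestors_addresses[OF leaf(1)] by blast
    then show "p \<in> unary_free (ancestors I)" using p by (auto simp: unary_free_def ancestors_def)
  qed
  moreover have "finite (unary_free (ancestors I))"
    using bij_betw_finite[OF \<psi>] finite_addresses by blast
  ultimately show ?thesis using bij_betw_same_card[OF \<psi>] card_mono by metis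
qed

lemma card_Leaves_graft:
  assumes "length Vs \<ge> 2"
  shows "card (Leaves (Some (graft Vs))) = (\<Sum>i<length Vs. card (Leaves (Some (Vs ! i))))"
proof -
  have "w \<in> Leaves (Some (graft Vs)) \<longleftrightarrow> w \<in> (\<Union>i<length Vs. (#) i ` Leaves (Some (Vs ! i)))" for w
    using assms by (cases w) auto
  then have "Leaves (Some (graft Vs)) = (\<Union>i<length Vs. (#) i ` Leaves (Some (Vs ! i)))" by blast
  also have "card \<dots> = (\<Sum>i<length Vs. card ((#) i ` Leaves (Some (Vs ! i))))"
    by (intro card_UN_disjoint) (auto simp: finite_Leaves)
  finally show ?thesis by (simp add: card_image)
qed

text \<open>Reducedness is essential, as unary vertices add no leaves. A grafting has at least two
  branches with a leaf in each, so with \<open>Suc n\<close> leaves it has at most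
  \<open>Suc n\<close> branches and each of them has at most \<open>n\<close> leaves.\<close>

lemma finite_bounded_leaves: "finite {V. card (Leaves (Some V)) \<le> n}"
proof (induction n)
  case 0
  then show ?case using finite_Leaves Leaves_nonempty by simp
next
  case (Suc n)
  have pos: "1 \<le> card (Leaves (Some V))" for V
    using finite_Leaves Leaves_nonempty by (simp add: Suc_le_eq card_gt_0_iff)
  have "{V. card (Leaves (Some V)) \<le> Suc n} \<subseteq>
      insert x_tree (graft ` {Vs. set Vs \<subseteq> {V. card (Leaves (Some V)) \<le> n} \<and> length Vs \<le> Suc n})"
  proof
    fix V assume V: "V \<in> {V. card (Leaves (Some V)) \<le> Suc n}"
    show "V \<in> insert x_tree (graft ` {Vs. set Vs \<subseteq> {V. card (Leaves (Some V)) \<le> n} \<and> length Vs \<le> Suc n})"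
    proof (cases V rule: prt_cases)
      case (2 Vs)
      let ?c = "\<lambda>i. card (Leaves (Some (Vs ! i)))"
      have sum: "(\<Sum>i<length Vs. ?c i) \<le> Suc n" using V 2 card_Leaves_graft by simp
      moreover have "length Vs \<le> (\<Sum>i<length Vs. ?c i)"
        using sum_mono[of "{..<length Vs}" "\<lambda>_. 1" ?c] pos by simp
      moreover have "?c i \<le> n" if i: "i < length Vs" for i
      proof -
        \<comment> \<open>A second branch \<open>j\<close> uses up at least one leaf, which is then
          missing in branch \<open>i\<close>.\<close>
        obtain j where j: "j < length Vs" "j \<noteq> i"
          using 2(1) by (metis One_nat_def Suc_1 Suc_le_lessD less_Suc_eq_0_disj neq0_conv not_less_eq)
        have "(\<Sum>i\<in>{i, j}. ?c i) \<le> (\<Sum>i<length Vs. ?c i)"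
          using i j by (intro sum_mono2) auto
        then show ?thesis using j(2) pos[of "Vs ! j"] sum by simp
      qed
      ultimately have "Vs \<in> {Vs. set Vs \<subseteq> {V. card (Leaves (Some V)) \<le> n} \<and> length Vs \<le> Suc n}"
        by (auto simp: in_set_conv_nth)
      then show ?thesis using 2(2) by blast
    qed simp
  qed
  moreover have "finite \<dots>" using finite_lists_length_le[OF Suc] by simp
  ultimately show ?case using finite_subset by blast
qed

text \<open>A sum over an infinite index set is 0 by convention, so \<open>shuffle\<close> has the
  intended coefficients only by this. The leaves of V split into two sets, bounded in terms of
  \<open>S\<close> and \<open>T\<close>.\<close>

lemma finite_shuffle_support: "finite {V. N_set (Some S) (Some T) V \<noteq> {}}"
proof -
  let ?b = "card {p. is_addr p (Rep_prt S)} + card {p. is_addr p (Rep_prt T)}"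
  have "{V. N_set (Some S) (Some T) V \<noteq> {}} \<subseteq> Some ` {V. card (Leaves (Some V)) \<le> ?b}"
  proof
    fix V assume "V \<in> {V. N_set (Some S) (Some T) V \<noteq> {}}"
    then obtain I where I: "I \<in> N_set (Some S) (Some T) V" by blast
    then obtain V' where V: "V = Some V'" by (cases V) (auto simp: N_set_def)
    have *: "I \<subseteq> Leaves (Some V')" "contraction (Some V') I = Some S"
      "contraction (Some V') (Leaves (Some V') - I) = Some T"
      using I V by (simp_all add: mem_N_set)
    have "card (Leaves (Some V')) = card I + card (Leaves (Some V') - I)"
      using *(1) finite_Leaves by (metis card_Diff_subset card_mono finite_subset le_add_diff_inverse)
    also have "\<dots> \<le> ?b" using * by (intro add_mono card_le_card_addresses) auto
    finally show "V \<in> Some ` {V. card (Leaves (Some V)) \<le> ?b}" using V by blast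
  qed
  then show ?thesis using finite_bounded_leaves finite_subset by blast
qed

lemma lookup_shuffle:
  "Poly_Mapping.lookup (shuffle (Some S) (Some T)) V = of_nat (card (N_set (Some S) (Some T) V))"
proof -
  have "Poly_Mapping.lookup (shuffle (Some S) (Some T)) V =
      (\<Sum>W | N_set (Some S) (Some T) W \<noteq> {}. of_nat (card (N_set (Some S) (Some T) W)) when W = V)"
    by (simp add: shuffle_def lookup_sum lookup_single)
  also have "\<dots> = of_nat (card (N_set (Some S) (Some T) V))"
    using finite_shuffle_support[of S T] by (simp add: when_def if_distrib sum.delta cong: if_cong)
  finally show ?thesis .
qed


section \<open>Positions\<close>

lemma index_in_sorted_list:
  assumes "finite \<alpha>" "i < card \<alpha>"
  shows "index_in \<alpha> (sorted_list_of_set \<alpha> ! i) = Suc i"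
  unfolding index_in_def
proof (rule the_equality)
  show "Suc i \<in> {1..card \<alpha>} \<and> ith \<alpha> (Suc i) = sorted_list_of_set \<alpha> ! i"
    using assms by (simp add: ith_def)
next
  fix j assume j: "j \<in> {1..card \<alpha>} \<and> ith \<alpha> j = sorted_list_of_set \<alpha> ! i"
  then have "j - 1 < length (sorted_list_of_set \<alpha>)" using assms by auto
  then have "j - 1 = i" using j assms nth_eq_iff_index_eq[of "sorted_list_of_set \<alpha>" "j - 1" i]
    by (simp add: ith_def)
  with j show "j = Suc i" by auto
qed

text \<open>Counting replaces the definite description in \<open>index_in\<close>, which makes ranks
  in \<open>{1..k}\<close> and \<open>{1..k} - {\<nu>}\<close> computable.\<close>

lemma index_in_eq_card:
  assumes "finite \<alpha>" "j \<in> \<alpha>"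
  shows "index_in \<alpha> j = card {i \<in> \<alpha>. i \<le> j}"
proof -
  let ?xs = "sorted_list_of_set \<alpha>"
  obtain i where i: "i < card \<alpha>" "?xs ! i = j"
    using assms by (metis in_set_conv_nth set_sorted_list_of_set length_sorted_list_of_set)
  have sw: "sorted_wrt (<) ?xs" by (simp add: strict_sorted_iff)
  have le: "?xs ! l \<le> ?xs ! i \<longleftrightarrow> l \<le> i" if "l < card \<alpha>" for l
    using sorted_wrt_nth_less[OF sw, of l i] sorted_wrt_nth_less[OF sw, of i l] that i(1)
    by (cases l i rule: linorder_cases) auto
  have "{x \<in> \<alpha>. x \<le> j} = (!) ?xs ` {..i}"
  proof (intro equalityI subsetI)
    fix x assume x: "x \<in> {x \<in> \<alpha>. x \<le> j}"
    then obtain l where "l < card \<alpha>" "?xs ! l = x"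
      using assms by (metis (no_types, lifting) in_set_conv_nth length_sorted_list_of_set mem_Collect_eq set_sorted_list_of_set)
    with x i(2) le show "x \<in> (!) ?xs ` {..i}" by auto
  next
    fix x assume "x \<in> (!) ?xs ` {..i}"
    then obtain l where l: "l \<le> i" "x = ?xs ! l" by auto
    then have "l < card \<alpha>" using i(1) by simp
    then have "x \<in> \<alpha>" using l(2) assms(1) by (metis nth_mem set_sorted_list_of_set length_sorted_list_of_set)
    with le[OF \<open>l < card \<alpha>\<close>] l i(2) show "x \<in> {x \<in> \<alpha>. x \<le> j}" by simp
  qed
  moreover have "inj_on ((!) ?xs) {..i}"
    using i(1) by (auto simp: inj_on_def nth_eq_iff_index_eq)
  ultimately have "card {x \<in> \<alpha>. x \<le> j} = Suc i" by (simp add: card_image)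
  then show ?thesis using index_in_sorted_list[OF assms(1) i(1)] i(2) by simp
qed

text \<open>\<open>None\<close> is the empty tree \<open>1\<close>, the contraction of a branch without selected leaves.\<close>

definition place :: "'a list \<Rightarrow> nat set \<Rightarrow> nat \<Rightarrow> 'a option" where
  "place \<sigma> \<alpha> j = (if j \<in> \<alpha> then Some (\<sigma> ! (index_in \<alpha> j - 1)) else None)"

lemma place_eq_None_iff [simp]: "place \<sigma> \<alpha> j = None \<longleftrightarrow> j \<notin> \<alpha>"
  by (simp add: place_def)

lemma map_place_sorted_list:
  assumes "finite \<alpha>" "card \<alpha> = length \<sigma>"
  shows "map (\<lambda>j. the (place \<sigma> \<alpha> j)) (sorted_list_of_set \<alpha>) = \<sigma>"
proof (rule nth_equalityI)
  fix i assume "i < length (map (\<lambda>j. the (place \<sigma> \<alpha> j)) (sorted_list_of_set \<alpha>))"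
  then have i: "i < card \<alpha>" by simp
  then have "sorted_list_of_set \<alpha> ! i \<in> \<alpha>"
    using assms(1) by (metis nth_mem set_sorted_list_of_set length_sorted_list_of_set)
  then show "map (\<lambda>j. the (place \<sigma> \<alpha> j)) (sorted_list_of_set \<alpha>) ! i = \<sigma> ! i"
    using i index_in_sorted_list[OF assms(1) i] by (simp add: place_def)
qed (use assms in simp)

lemma place_map_sorted_list:
  assumes "finite \<alpha>" "j \<in> \<alpha>"
  shows "place (map f (sorted_list_of_set \<alpha>)) \<alpha> j = Some (f j)"
proof -
  obtain i where i: "i < card \<alpha>" "sorted_list_of_set \<alpha> ! i = j"
    using assms by (metis in_set_conv_nth set_sorted_list_of_set length_sorted_list_of_set)
  then show ?thesis using assms index_in_sorted_list[OF assms(1) i(1)] by (simp add: place_def)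
qed

lemma filter_upt_eq_sorted_list: "filter P [a..<b] = sorted_list_of_set {j \<in> {a..<b}. P j}"
  by (rule sorted_distinct_set_unique) (auto simp: sorted_wrt_filter)

text \<open>A finite sequence of options is the same as its set of nonempty positions together with
  the list of its entries there; \<open>place\<close> rebuilds the sequence from these data.\<close>

lemma somes_eq_iff_place:
  "map the (filter (\<lambda>s. s \<noteq> None) (map os [1..<Suc k])) = \<sigma> \<longleftrightarrow>
     (\<exists>\<alpha>\<subseteq>{1..k}. card \<alpha> = length \<sigma> \<and> (\<forall>j\<in>{1..k}. os j = place \<sigma> \<alpha> j))"
proof -
  let ?\<alpha> = "{j \<in> {1..<Suc k}. os j \<noteq> None}"
  have somes: "map the (filter (\<lambda>s. s \<noteq> None) (map os [1..<Suc k])) =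
      map (\<lambda>j. the (os j)) (sorted_list_of_set ?\<alpha>)"
    by (simp only: filter_map map_map o_def filter_upt_eq_sorted_list)
  show ?thesis
  proof
    assume "map the (filter (\<lambda>s. s \<noteq> None) (map os [1..<Suc k])) = \<sigma>"
    then have \<sigma>: "\<sigma> = map (\<lambda>j. the (os j)) (sorted_list_of_set ?\<alpha>)" using somes by simp
    have "os j = place \<sigma> ?\<alpha> j" if "j \<in> {1..k}" for j
    proof (cases "os j")
      case None
      then show ?thesis by (simp add: place_def)
    next
      case (Some s)
      with that have "j \<in> ?\<alpha>" by auto
      with Some show ?thesis unfolding \<sigma> by (subst place_map_sorted_list) auto
    qed
    moreover have "card ?\<alpha> = length \<sigma>" by (simp add: \<sigma>)
    ultimately show "\<exists>\<alpha>\<subseteq>{1..k}. card \<alpha> = length \<sigma> \<and> (\<forall>j\<in>{1..k}. os j = place \<sigma> \<alpha> j)"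
      by (intro exI[of _ ?\<alpha>]) auto
  next
    assume "\<exists>\<alpha>\<subseteq>{1..k}. card \<alpha> = length \<sigma> \<and> (\<forall>j\<in>{1..k}. os j = place \<sigma> \<alpha> j)"
    then obtain \<alpha> where \<alpha>: "\<alpha> \<subseteq> {1..k}" "card \<alpha> = length \<sigma>"
      and os: "\<And>j. j \<in> {1..k} \<Longrightarrow> os j = place \<sigma> \<alpha> j" by blast
    have fin: "finite \<alpha>" using \<alpha>(1) finite_subset by blast
    have "os j \<noteq> None \<longleftrightarrow> j \<in> \<alpha>" if "j \<in> {1..k}" for j
      using os[OF that] by (simp only: place_eq_None_iff not_not)
    then have "?\<alpha> = {j \<in> {1..<Suc k}. j \<in> \<alpha>}"
      by (intro Collect_cong conj_cong) (simp_all del: not_None_eq)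
    also have "\<dots> = \<alpha>" using \<alpha>(1) by auto
    finally have "?\<alpha> = \<alpha>" .
    moreover have "map (\<lambda>j. the (os j)) (sorted_list_of_set \<alpha>) =
        map (\<lambda>j. the (place \<sigma> \<alpha> j)) (sorted_list_of_set \<alpha>)"
      using \<alpha>(1) fin os by (intro map_cong) auto
    ultimately show "map the (filter (\<lambda>s. s \<noteq> None) (map os [1..<Suc k])) = \<sigma>"
      using somes map_place_sorted_list[OF fin \<alpha>(2)] by simp
  qed
qed

lemma in_listset_iff: "xs \<in> listset As \<longleftrightarrow> length xs = length As \<and> (\<forall>i<length As. xs ! i \<in> As ! i)"
proof (induction As arbitrary: xs)
  case (Cons A As)
  show ?case
    by (cases xs) (auto simp: set_Cons_def Cons nth_Cons split: nat.splits)
qed auto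

lemma finite_listset: "(\<And>A. A \<in> set As \<Longrightarrow> finite A) \<Longrightarrow> finite (listset As)"
proof (induction As)
  case (Cons A As)
  have "set_Cons A (listset As) = (\<lambda>(x, xs). x # xs) ` (A \<times> listset As)"
    by (auto simp: set_Cons_def)
  then show ?case using Cons by simp
qed simp

text \<open>The union of four sets becomes two independent alternatives, one for each of S and
  T.\<close>

lemma Gamma_bar_iff:
  "(\<alpha>, \<beta>) \<in> Gamma_bar k m n \<longleftrightarrow> \<alpha> \<noteq> {} \<and> \<beta> \<noteq> {} \<and> \<alpha> \<union> \<beta> = {1..k} \<and>
     (card \<alpha> = 1 \<or> card \<alpha> = m) \<and> (card \<beta> = 1 \<or> card \<beta> = n)"
  by (auto simp: Gamma_bar_def Gamma_def)

lemma Gamma_bar_subset: "Gamma_bar k m n \<subseteq> Pow {1..k} \<times> Pow {1..k}"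
  by (auto simp: Gamma_bar_def Gamma_def)

lemma finite_Gamma_bar: "finite (Gamma_bar k m n)"
  using finite_subset[OF Gamma_bar_subset] by blast

text \<open>Two sets of at most m and n elements cannot cover more than m + n positions, so the
  upper limit of the outer sum in the theorem loses nothing.\<close>

lemma Gamma_bar_empty:
  assumes "m \<ge> 1" "n \<ge> 1" "m + n < k"
  shows "Gamma_bar k m n = {}"
proof -
  have "k \<le> m + n" if "(\<alpha>, \<beta>) \<in> Gamma_bar k m n" for \<alpha> \<beta>
    using that assms card_Un_le[of \<alpha> \<beta>] by (auto simp: Gamma_bar_iff)
  with assms(3) show ?thesis by fastforce
qed


section \<open>Coefficients of the shuffle product\<close>

lemma lookup_grafting:
  fixes ps :: "(prt option \<Rightarrow>\<^sub>0 'k::field) list"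
  shows "Poly_Mapping.lookup (grafting ps) W =
    (\<Sum>ts\<in>listset (map (\<lambda>p. {t. Some t \<in> Poly_Mapping.keys p}) ps).
       (\<Prod>i<length ps. Poly_Mapping.lookup (ps ! i) (Some (ts ! i))) when Some (graft ts) = W)"
  by (simp add: grafting_def lookup_sum lookup_single)

text \<open>\<open>graft\<close> is injective on lists of length at least 2, so only the tuple
  \<open>Vs\<close> itself contributes.\<close>

lemma lookup_grafting_graft:
  fixes ps :: "(prt option \<Rightarrow>\<^sub>0 'k::field) list"
  assumes "length ps \<ge> 2" "length Vs \<ge> 2"
  shows "Poly_Mapping.lookup (grafting ps) (Some (graft Vs)) =
    (if length ps = length Vs then \<Prod>i<length Vs. Poly_Mapping.lookup (ps ! i) (Some (Vs ! i)) else 0)"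
proof -
  let ?keys = "\<lambda>p::prt option \<Rightarrow>\<^sub>0 'k. {t. Some t \<in> Poly_Mapping.keys p}"
  let ?L = "listset (map ?keys ps)"
  let ?c = "\<lambda>ts. \<Prod>i<length ps. Poly_Mapping.lookup (ps ! i) (Some (ts ! i))"
  have "finite (?keys p)" for p :: "prt option \<Rightarrow>\<^sub>0 'k"
    using finite_vimageI[of "Poly_Mapping.keys p" Some] by (simp add: vimage_def)
  then have fin: "finite ?L" by (intro finite_listset) auto
  have "Poly_Mapping.lookup (grafting ps) (Some (graft Vs)) = (\<Sum>ts\<in>?L. if ts = Vs then ?c ts else 0)"
    unfolding lookup_grafting
  proof (rule sum.cong)
    fix ts assume "ts \<in> ?L"
    then have "length ts \<noteq> 1" using assms(1) by (simp add: in_listset_iff)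
    then show "(?c ts when Some (graft ts) = Some (graft Vs)) = (if ts = Vs then ?c ts else 0)"
      using graft_eq_iff[of ts Vs] assms(2) by (simp add: when_def)
  qed simp
  also have "\<dots> = (if Vs \<in> ?L then ?c Vs else 0)"
    using fin by simp
  also have "\<dots> = (if length ps = length Vs then
      \<Prod>i<length Vs. Poly_Mapping.lookup (ps ! i) (Some (Vs ! i)) else 0)"
  \<comment> \<open>If \<open>Vs\<close> lies outside the product of the supports, one factor has
    coefficient 0 and the product formula gives 0 as well.\<close>
  proof (cases "length ps = length Vs \<and> Vs \<notin> ?L")
    case True
    then obtain i where "i < length Vs" "Poly_Mapping.lookup (ps ! i) (Some (Vs ! i)) = 0"
      by (auto simp: in_listset_iff in_keys_iff)
    then have "(\<Prod>i<length Vs. Poly_Mapping.lookup (ps ! i) (Some (Vs ! i))) = 0"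
      by (intro prod_zero) auto
    then show ?thesis using True by simp
  qed (auto simp: in_listset_iff)
  finally show ?thesis .
qed

lemma lookup_grafting_not_graft:
  assumes "length ps \<ge> 2" "\<And>Vs. length Vs \<ge> 2 \<Longrightarrow> W \<noteq> Some (graft Vs)"
  shows "Poly_Mapping.lookup (grafting ps) W = 0"
  unfolding lookup_grafting
proof (rule sum.neutral, rule ballI)
  fix ts assume "ts \<in> listset (map (\<lambda>p. {t. Some t \<in> Poly_Mapping.keys p}) ps)"
  then have "W \<noteq> Some (graft ts)" using assms by (simp add: in_listset_iff)
  then show "((\<Prod>i<length ps. Poly_Mapping.lookup (ps ! i) (Some (ts ! i))) when Some (graft ts) = W) = 0"
    by (simp add: when_def)
qed

text \<open>A basis factor is a shuffle with the empty tree, so all three kinds of factors have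
  coefficients of the same form.\<close>

lemma lookup_P_factor:
  assumes "j \<in> \<alpha> \<union> \<beta>"
  shows "Poly_Mapping.lookup (P_factor \<sigma> \<tau> \<alpha> \<beta> j) (Some V) =
    of_nat (card (N_set (place \<sigma> \<alpha> j) (place \<tau> \<beta> j) (Some V)))"
proof -
  consider "j \<in> \<alpha>" "j \<notin> \<beta>" | "j \<notin> \<alpha>" "j \<in> \<beta>" | "j \<in> \<alpha>" "j \<in> \<beta>" using assms by blast
  then show ?thesis
  proof cases
    case 1
    then show ?thesis
      by (auto simp: P_factor_def place_def basis_def lookup_single N_set_None_right)
  next
    case 2
    then show ?thesis
      by (auto simp: P_factor_def place_def basis_def lookup_single N_set_None_left)
  next
    case 3
    then show ?thesis by (simp add: P_factor_def place_def lookup_shuffle)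
  qed
qed

section \<open>The cases of \<open>R_elem\<close> as one grafting of general factors\<close>

lemma P_factor_commute: "P_factor \<sigma> \<tau> \<alpha> \<beta> j = P_factor \<tau> \<sigma> \<beta> \<alpha> j" if "j \<in> \<alpha> \<union> \<beta>"
  using that by (auto simp: P_factor_def Let_def shuffle_commute)

lemma index_in_interval: "j \<in> {1..k} \<Longrightarrow> index_in {1..k} j = j"
proof -
  assume j: "j \<in> {1..k}"
  then have "{i \<in> {1..k}. i \<le> j} = {1..j}" by auto
  with j show ?thesis by (simp add: index_in_eq_card)
qed

lemma index_in_interval_minus:
  assumes "j \<in> {1..k}" "j \<noteq> \<nu>" "\<nu> \<in> {1..k}"
  shows "index_in ({1..k} - {\<nu>}) j = (if j < \<nu> then j else j - 1)"
proof (cases "j < \<nu>")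
  case True
  with assms have "{i \<in> {1..k} - {\<nu>}. i \<le> j} = {1..j}" by auto
  with True assms show ?thesis by (simp add: index_in_eq_card)
next
  case False
  with assms have "{i \<in> {1..k} - {\<nu>}. i \<le> j} = {1..j} - {\<nu>}" by auto
  with False assms show ?thesis by (simp add: index_in_eq_card)
qed

lemma index_in_singleton [simp]: "index_in {\<nu>} \<nu> = 1"
proof -
  have "{i \<in> {\<nu>}. i \<le> \<nu>} = {\<nu>}" by auto
  then show ?thesis by (simp add: index_in_eq_card)
qed

text \<open>The general factors with the one-element list \<open>[S]\<close>: positions beyond \<nu>
  have rank one less in the complement of \<nu>, which is the shift made by inserting S.\<close>

lemma map_P_factor_insert:
  assumes "\<nu> \<in> {1..Suc (length Ts)}"
  shows "map (P_factor [S] Ts {\<nu>} ({1..Suc (length Ts)} - {\<nu>})) [1..<Suc (length Ts) + 1] =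
    map basis (take (\<nu> - 1) Ts) @ [basis S] @ map basis (drop (\<nu> - 1) Ts)"
proof (rule nth_equalityI)
  fix i assume "i < length (map (P_factor [S] Ts {\<nu>} ({1..Suc (length Ts)} - {\<nu>})) [1..<Suc (length Ts) + 1])"
  then have i: "i < Suc (length Ts)" by (simp del: upt_Suc)
  consider "Suc i < \<nu>" | "Suc i = \<nu>" | "Suc i > \<nu>" by linarith
  then show "map (P_factor [S] Ts {\<nu>} ({1..Suc (length Ts)} - {\<nu>})) [1..<Suc (length Ts) + 1] ! i =
      (map basis (take (\<nu> - 1) Ts) @ [basis S] @ map basis (drop (\<nu> - 1) Ts)) ! i"
  proof cases
    case 1
    then show ?thesis using assms i index_in_interval_minus[of "Suc i" "Suc (length Ts)" \<nu>]
      by (auto simp: P_factor_def nth_append simp del: upt_Suc)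
  next
    case 2
    then show ?thesis using assms i
      by (auto simp: P_factor_def nth_append simp del: upt_Suc)
  next
    case 3
    then show ?thesis using assms i index_in_interval_minus[of "Suc i" "Suc (length Ts)" \<nu>]
      by (auto simp: P_factor_def nth_append nth_Cons' simp del: upt_Suc)
  qed
qed (use assms in auto)

text \<open>Here ranks are positions, and S meets the tree at \<nu> in the only shuffled factor. The
  two arguments of that shuffle are in the opposite order in \<open>P_factor\<close>, hence the
  appeal to commutativity.\<close>

lemma map_P_factor_merge:
  assumes "\<nu> \<in> {1..length Ts}"
  shows "map (P_factor [S] Ts {\<nu>} {1..length Ts}) [1..<length Ts + 1] =
    map basis (take (\<nu> - 1) Ts) @ [shuffle (Some (Ts ! (\<nu> - 1))) (Some S)] @ map basis (drop \<nu> Ts)"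
proof (rule nth_equalityI)
  fix i assume "i < length (map (P_factor [S] Ts {\<nu>} {1..length Ts}) [1..<length Ts + 1])"
  then have i: "i < length Ts" by (simp del: upt_Suc)
  have idx: "index_in {1..length Ts} (Suc i) = Suc i" using i by (intro index_in_interval) simp
  consider "Suc i < \<nu>" | "Suc i = \<nu>" | "Suc i > \<nu>" by linarith
  then show "map (P_factor [S] Ts {\<nu>} {1..length Ts}) [1..<length Ts + 1] ! i =
      (map basis (take (\<nu> - 1) Ts) @ [shuffle (Some (Ts ! (\<nu> - 1))) (Some S)] @ map basis (drop \<nu> Ts)) ! i"
  proof cases
    case 1
    then show ?thesis using assms i idx
      by (auto simp: P_factor_def nth_append simp del: upt_Suc)
  next
    case 2
    then show ?thesis using assms i idx
      by (auto simp: P_factor_def nth_append shuffle_commute[of "Some S"] simp del: upt_Suc)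
  next
    case 3
    then show ?thesis using assms i idx
      by (auto simp: P_factor_def nth_append nth_Cons' simp del: upt_Suc)
  qed
qed (use assms in auto)

text \<open>
  The branches contributed by a tree \<open>S\<close> occupying the positions \<open>\<alpha>\<close>: either \<open>S\<close> as a
  whole sits in one branch, or the root of \<open>S\<close> is the root of the big tree.
\<close>

definition factors :: "prt \<Rightarrow> prt list \<Rightarrow> nat set \<Rightarrow> prt list" where
  "factors S Ss \<alpha> = (if card \<alpha> = 1 then [S] else Ss)"

lemma Gamma_singleton_cases:
  assumes "{\<nu>} \<union> \<beta> = {1..k}"
  obtains "\<nu> \<in> {1..k}" "\<beta> = {1..k}" "k = card \<beta>" |
    "\<nu> \<in> {1..k}" "\<beta> = {1..k} - {\<nu>}" "k = card \<beta> + 1"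
proof (cases "\<nu> \<in> \<beta>")
  case True
  then have \<beta>: "\<beta> = {1..k}" using assms by auto
  moreover have "\<nu> \<in> {1..k}" using True unfolding \<beta> .
  moreover have "k = card \<beta>" unfolding \<beta> by simp
  ultimately show thesis using that(1) by blast
next
  case False
  then have \<beta>: "\<beta> = {1..k} - {\<nu>}" and \<nu>: "\<nu> \<in> {1..k}" using assms by auto
  moreover have "k = card \<beta> + 1" using \<nu> unfolding \<beta> by simp
  ultimately show thesis using that(2) by blast
qed

lemma map_P_factor_single:
  assumes "{\<nu>} \<union> \<beta> = {1..k}" "card \<beta> = length Ts"
  shows "map (P_factor [S] Ts {\<nu>} \<beta>) [1..<k + 1] =
    (if k = length Ts + 1
     then map basis (take (\<nu> - 1) Ts) @ [basis S] @ map basis (drop (\<nu> - 1) Ts)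
     else map basis (take (\<nu> - 1) Ts) @ [shuffle (Some (Ts ! (\<nu> - 1))) (Some S)] @ map basis (drop \<nu> Ts))"
  using assms(1)
proof (cases rule: Gamma_singleton_cases)
  case 1
  have k: "k = length Ts" using 1(3) assms(2) by simp
  show ?thesis using map_P_factor_merge[of \<nu> Ts S] 1(1) unfolding 1(2) k by simp
next
  case 2
  have k: "k = Suc (length Ts)" using 2(3) assms(2) by simp
  show ?thesis using map_P_factor_insert[of \<nu> Ts S] 2(1) unfolding 2(2) k by simp
qed

lemma R_elem_eq_grafting:
  assumes k: "k \<ge> 2" and \<Gamma>: "(\<alpha>, \<beta>) \<in> Gamma_bar k (length Ss) (length Ts)"
  shows "R_elem S Ss T Ts k \<alpha> \<beta> =
    grafting (map (P_factor (factors S Ss \<alpha>) (factors T Ts \<beta>) \<alpha> \<beta>) [1..<k + 1])"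
proof -
  have un: "\<alpha> \<union> \<beta> = {1..k}" and c: "card \<alpha> = 1 \<or> card \<alpha> = length Ss" "card \<beta> = 1 \<or> card \<beta> = length Ts"
    using \<Gamma> by (simp_all add: Gamma_bar_iff)
  consider "card \<alpha> = 1" "card \<beta> = 1" | "card \<alpha> = 1" "card \<beta> \<noteq> 1"
    | "card \<alpha> \<noteq> 1" "card \<beta> = 1" | "card \<alpha> \<noteq> 1" "card \<beta> \<noteq> 1" by blast
  then show ?thesis
  proof cases
    case 1
    then obtain a b where ab: "\<alpha> = {a}" "\<beta> = {b}" by (meson card_1_singletonE)
    have "k \<le> 2" using card_Un_le[of \<alpha> \<beta>] un 1 by simp
    then have k2: "k = 2" using k by simp
    have "{1..2} = {1, 2::nat}" by auto
    then have "{a, b} = {1, 2}" using un unfolding ab k2 by (simp add: insert_commute)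
    then consider "a = 1" "b = 2" | "a = 2" "b = 1" by (auto simp: doubleton_eq_iff)
    then show ?thesis
    proof cases
      case 1
      have "[1..<k + 1] = [1, 2]" by (simp add: k2 upt_rec numeral_2_eq_2)
      then show ?thesis using ab 1 by (simp add: R_elem_def factors_def P_factor_def)
    next
      case 2
      have "[1..<k + 1] = [1, 2]" by (simp add: k2 upt_rec numeral_2_eq_2)
      then show ?thesis using ab 2 by (simp add: R_elem_def factors_def P_factor_def)
    qed
  next
    case 2
    then obtain \<nu> where \<nu>: "\<alpha> = {\<nu>}" by (meson card_1_singletonE)
    have f: "factors S Ss \<alpha> = [S]" "factors T Ts \<beta> = Ts" using 2 by (simp_all add: factors_def)
    have "{\<nu>} \<union> \<beta> = {1..k}" "card \<beta> = length Ts" using un \<nu> 2 c by simp_all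
    note map = map_P_factor_single[OF this, of S]
    show ?thesis
      unfolding f unfolding \<nu> map using 2 by (simp add: R_elem_def)
  next
    case 3
    then obtain \<mu> where \<mu>: "\<beta> = {\<mu>}" by (meson card_1_singletonE)
    have f: "factors S Ss \<alpha> = Ss" "factors T Ts \<beta> = [T]" using 3 by (simp_all add: factors_def)
    have "{\<mu>} \<union> \<alpha> = {1..k}" "card \<alpha> = length Ss" using un \<mu> 3 c by (simp_all add: Un_commute)
    note map = map_P_factor_single[OF this, of T]
    \<comment> \<open>Exchanging the roles of S and T reduces this case to the preceding one,
      because the factors are symmetric.\<close>
    have comm: "map (P_factor Ss [T] \<alpha> {\<mu>}) [1..<k + 1] = map (P_factor [T] Ss {\<mu>} \<alpha>) [1..<k + 1]"
      using un \<mu> by (intro map_cong P_factor_commute) auto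
    show ?thesis
      unfolding f unfolding \<mu> comm map using 3 by (simp add: R_elem_def)
  next
    case 4
    then show ?thesis by (simp add: R_elem_def factors_def)
  qed
qed

section \<open>Splitting a leaf set over the branches\<close>

lemma branch_part_diff:
  "length Vs \<ge> 2 \<Longrightarrow> i < length Vs \<Longrightarrow>
     branch_part i (Leaves (Some (graft Vs)) - I) = Leaves (Some (Vs ! i)) - branch_part i I"
  by (auto simp: branch_part_def)

text \<open>The list criterion of \<open>contraction_graft_eq_iff\<close> is read as a condition on
  each branch; \<alpha> is the set of positions of the branches that meet \<open>I\<close>.\<close>

lemma contraction_graft_place:
  assumes Vs: "length Vs \<ge> 2" and I: "I \<subseteq> Leaves (Some (graft Vs))" and S: "decomposition S Ss"
  shows "contraction (Some (graft Vs)) I = Some S \<longleftrightarrow>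
    (\<exists>\<alpha>\<subseteq>{1..length Vs}. \<alpha> \<noteq> {} \<and> (card \<alpha> = 1 \<or> card \<alpha> = length Ss) \<and>
      (\<forall>i<length Vs. contraction (Some (Vs ! i)) (branch_part i I) = place (factors S Ss \<alpha>) \<alpha> (Suc i)))"
    (is "_ \<longleftrightarrow> ?R")
proof -
  define os where "os j = contraction (Some (Vs ! (j - 1))) (branch_part (j - 1) I)" for j
  let ?k = "length Vs"
  let ?E = "\<lambda>\<sigma>. \<exists>\<alpha>\<subseteq>{1..?k}. card \<alpha> = length \<sigma> \<and> (\<forall>j\<in>{1..?k}. os j = place \<sigma> \<alpha> j)"
  have "map os [1..<Suc ?k] = map (\<lambda>i. contraction (Some (Vs ! i)) (branch_part i I)) [0..<?k]"
    by (simp add: os_def flip: map_Suc_upt del: upt_Suc)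
  then have parts: "contraction_parts Vs I = \<sigma> \<longleftrightarrow> ?E \<sigma>" for \<sigma>
    unfolding contraction_parts_def by (simp only: flip: somes_eq_iff_place)
  have all: "(\<forall>j\<in>{1..?k}. os j = f j) \<longleftrightarrow>
      (\<forall>i<?k. contraction (Some (Vs ! i)) (branch_part i I) = f (Suc i))" for f
    unfolding image_Suc_lessThan[symmetric] by (auto simp: os_def)
  have "contraction (Some (graft Vs)) I = Some S \<longleftrightarrow> ?E [S] \<or> ?E Ss"
    unfolding contraction_graft_eq_iff[OF assms] insert_iff parts by simp
  also have "\<dots> \<longleftrightarrow> ?R"
  proof
    assume "?E [S] \<or> ?E Ss"
    then obtain \<alpha> \<sigma> where \<alpha>: "\<alpha> \<subseteq> {1..?k}" "card \<alpha> = length \<sigma>" "\<forall>j\<in>{1..?k}. os j = place \<sigma> \<alpha> j"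
      and \<sigma>: "\<sigma> = [S] \<or> \<sigma> = Ss" by blast
    \<comment> \<open>The length of \<open>\<sigma>\<close> decides between the two lists, except
      when \<open>Ss\<close> has length 1, and then they coincide.\<close>
    have \<sigma>_eq: "\<sigma> = factors S Ss \<alpha>"
      using \<alpha>(2) \<sigma> decomposition_length_1[OF S] by (auto simp: factors_def)
    have "card \<alpha> = 1 \<or> card \<alpha> = length Ss" using \<alpha>(2) \<sigma> by auto
    moreover have "card \<alpha> \<noteq> 0" using \<alpha>(2) \<sigma> S by (auto elim: decomposition_cases)
    then have "\<alpha> \<noteq> {}" by auto
    ultimately show ?R using \<alpha>(1,3) unfolding \<sigma>_eq all by blast
  next
    assume ?R
    then obtain \<alpha> where \<alpha>: "\<alpha> \<subseteq> {1..?k}" "card \<alpha> = 1 \<or> card \<alpha> = length Ss"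
      "\<forall>j\<in>{1..?k}. os j = place (factors S Ss \<alpha>) \<alpha> j"
      unfolding all by blast
    show "?E [S] \<or> ?E Ss"
    proof (cases "card \<alpha> = 1")
      case True
      then have "?E [S]" using \<alpha> by (intro exI[of _ \<alpha>]) (auto simp: factors_def)
      then show ?thesis ..
    next
      case False
      then have "?E Ss" using \<alpha> by (intro exI[of _ \<alpha>]) (auto simp: factors_def)
      then show ?thesis ..
    qed
  qed
  finally show ?thesis .
qed

text \<open>\<open>s\<close> and \<open>t\<close> prescribe the two contractions on each branch.
  They are indexed from 1, like the elements of \<alpha> and \<beta>, whereas addresses number
  branches from 0.\<close>

definition branchwise :: "prt list \<Rightarrow> (nat \<Rightarrow> prt option) \<Rightarrow> (nat \<Rightarrow> prt option) \<Rightarrow> nat list set set" where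
  "branchwise Vs s t = {I. I \<subseteq> Leaves (Some (graft Vs)) \<and>
     (\<forall>i<length Vs. branch_part i I \<in> N_set (s (Suc i)) (t (Suc i)) (Some (Vs ! i)))}"

text \<open>A leaf set of a grafting is a free choice of one leaf set per branch. The restriction to
  \<open>{..<?k}\<close> makes such families elements of a dependent product, whose cardinality is a
  product.\<close>

lemma card_branchwise:
  assumes Vs: "length Vs \<ge> 2"
  shows "card (branchwise Vs s t) =
    (\<Prod>i<length Vs. card (N_set (s (Suc i)) (t (Suc i)) (Some (Vs ! i))))"
proof -
  let ?k = "length Vs" and ?A = "\<lambda>i. N_set (s (Suc i)) (t (Suc i)) (Some (Vs ! i))"
  define g where "g F = {i # p | i p. i < ?k \<and> p \<in> F i}" for F :: "nat \<Rightarrow> nat list set"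
  have part: "branch_part i (g F) = F i" if "i < ?k" for i F
    using that by (auto simp: branch_part_def g_def)
  have "bij_betw (\<lambda>I. \<lambda>i\<in>{..<?k}. branch_part i I) (branchwise Vs s t) (PiE {..<?k} ?A)"
  proof (rule bij_betwI[where g = g])
    show "(\<lambda>I. \<lambda>i\<in>{..<?k}. branch_part i I) \<in> branchwise Vs s t \<rightarrow> PiE {..<?k} ?A"
      by (auto simp: branchwise_def)
    show "g \<in> PiE {..<?k} ?A \<rightarrow> branchwise Vs s t"
    proof
      fix F assume F: "F \<in> PiE {..<?k} ?A"
      then have "F i \<in> ?A i" if "i < ?k" for i using that by auto
      moreover then have "g F \<subseteq> Leaves (Some (graft Vs))"
        using Vs by (fastforce simp: g_def mem_N_set)
      ultimately show "g F \<in> branchwise Vs s t" by (simp add: branchwise_def part)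
    qed
    show "g (\<lambda>i\<in>{..<?k}. branch_part i I) = I" if "I \<in> branchwise Vs s t" for I
    proof -
      have I: "I \<subseteq> Leaves (Some (graft Vs))" using that by (simp add: branchwise_def)
      have "w \<in> g (\<lambda>i\<in>{..<?k}. branch_part i I) \<longleftrightarrow> w \<in> I" for w
        using I Vs by (cases w) (auto simp: g_def branch_part_def)
      then show ?thesis by blast
    qed
    show "(\<lambda>i\<in>{..<?k}. branch_part i (g F)) = F" if "F \<in> PiE {..<?k} ?A" for F
    proof
      fix i show "(\<lambda>i\<in>{..<?k}. branch_part i (g F)) i = F i"
        using PiE_arb[OF that, of i] by (simp add: part restrict_def)
    qed
  qed
  from bij_betw_same_card[OF this] show ?thesis by (simp add: card_PiE)
qed

lemma N_set_graft:
  assumes Vs: "length Vs \<ge> 2" and S: "decomposition S Ss" and T: "decomposition T Ts"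
  shows "N_set (Some S) (Some T) (Some (graft Vs)) =
    (\<Union>(\<alpha>, \<beta>)\<in>Gamma_bar (length Vs) (length Ss) (length Ts).
       branchwise Vs (place (factors S Ss \<alpha>) \<alpha>) (place (factors T Ts \<beta>) \<beta>))" (is "?L = ?R")
proof (intro equalityI subsetI)
  let ?k = "length Vs"
  fix I assume "I \<in> ?L"
  then have I: "I \<subseteq> Leaves (Some (graft Vs))"
    and c: "contraction (Some (graft Vs)) I = Some S"
      "contraction (Some (graft Vs)) (Leaves (Some (graft Vs)) - I) = Some T"
    by (simp_all add: mem_N_set)
  from c(1) contraction_graft_place[OF Vs I S] obtain \<alpha>
    where \<alpha>: "\<alpha> \<subseteq> {1..?k}" "\<alpha> \<noteq> {}" "card \<alpha> = 1 \<or> card \<alpha> = length Ss"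
      "\<And>i. i < ?k \<Longrightarrow> contraction (Some (Vs ! i)) (branch_part i I) = place (factors S Ss \<alpha>) \<alpha> (Suc i)"
    by blast
  from c(2) contraction_graft_place[OF Vs Diff_subset T] obtain \<beta>
    where \<beta>: "\<beta> \<subseteq> {1..?k}" "\<beta> \<noteq> {}" "card \<beta> = 1 \<or> card \<beta> = length Ts"
      "\<And>i. i < ?k \<Longrightarrow> contraction (Some (Vs ! i)) (Leaves (Some (Vs ! i)) - branch_part i I) =
         place (factors T Ts \<beta>) \<beta> (Suc i)"
    using branch_part_diff[OF Vs] by auto
  have sub: "branch_part i I \<subseteq> Leaves (Some (Vs ! i))" if "i < ?k" for i
    using I Vs that by (auto simp: branch_part_def)
  \<comment> \<open>Every branch has a leaf, and that leaf belongs to \<open>I\<close> or to its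
    complement; this is where the covering condition on the index sets comes from.\<close>
  have "Suc i \<in> \<alpha> \<union> \<beta>" if i: "i < ?k" for i
  proof (rule ccontr)
    assume "Suc i \<notin> \<alpha> \<union> \<beta>"
    then have "branch_part i I = {}" "Leaves (Some (Vs ! i)) - branch_part i I = {}"
      using \<alpha>(4)[OF i] \<beta>(4)[OF i] by (metis UnCI contraction_eq_None_iff place_eq_None_iff)+
    then show False using Leaves_nonempty by auto
  qed
  then have "\<alpha> \<union> \<beta> = {1..?k}" using \<alpha>(1) \<beta>(1) unfolding image_Suc_lessThan[symmetric] by blast
  then have "(\<alpha>, \<beta>) \<in> Gamma_bar ?k (length Ss) (length Ts)"
    using \<alpha> \<beta> by (simp add: Gamma_bar_iff)
  moreover have "I \<in> branchwise Vs (place (factors S Ss \<alpha>) \<alpha>) (place (factors T Ts \<beta>) \<beta>)"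
    using I sub \<alpha>(4) \<beta>(4) by (simp add: branchwise_def mem_N_set)
  ultimately show "I \<in> ?R" by blast
next
  fix I assume "I \<in> ?R"
  then obtain \<alpha> \<beta> where \<Gamma>: "(\<alpha>, \<beta>) \<in> Gamma_bar (length Vs) (length Ss) (length Ts)"
    and I: "I \<in> branchwise Vs (place (factors S Ss \<alpha>) \<alpha>) (place (factors T Ts \<beta>) \<beta>)" by blast
  have sub: "I \<subseteq> Leaves (Some (graft Vs))" using I by (simp add: branchwise_def)
  have \<alpha>: "\<alpha> \<subseteq> {1..length Vs}" and \<beta>: "\<beta> \<subseteq> {1..length Vs}"
    using \<Gamma> by (auto simp: Gamma_bar_def Gamma_def)
  have "contraction (Some (graft Vs)) I = Some S"
    unfolding contraction_graft_place[OF Vs sub S]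
    using \<alpha> \<Gamma> I by (intro exI[of _ \<alpha>]) (auto simp: Gamma_bar_iff branchwise_def mem_N_set)
  moreover have "contraction (Some (graft Vs)) (Leaves (Some (graft Vs)) - I) = Some T"
    unfolding contraction_graft_place[OF Vs Diff_subset T]
    using \<beta> \<Gamma> I branch_part_diff[OF Vs]
    by (intro exI[of _ \<beta>]) (auto simp: Gamma_bar_iff branchwise_def mem_N_set)
  ultimately show "I \<in> ?L" using sub by (simp add: mem_N_set)
qed

text \<open>Both index sets are recovered from \<open>I\<close>, so the sets of leaf choices for
  different pairs are disjoint and their cardinalities add up.\<close>

lemma branchwise_place_positions:
  assumes I: "I \<in> branchwise Vs (place \<sigma> \<alpha>) (place \<tau> \<beta>)"
    and "\<alpha> \<subseteq> {1..length Vs}" "\<beta> \<subseteq> {1..length Vs}"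
  shows "\<alpha> = Suc ` {i. i < length Vs \<and> branch_part i I \<noteq> {}}"
    and "\<beta> = Suc ` {i. i < length Vs \<and> Leaves (Some (Vs ! i)) - branch_part i I \<noteq> {}}"
proof -
  have c: "contraction (Some (Vs ! i)) (branch_part i I) = place \<sigma> \<alpha> (Suc i)"
    "contraction (Some (Vs ! i)) (Leaves (Some (Vs ! i)) - branch_part i I) = place \<tau> \<beta> (Suc i)"
    if "i < length Vs" for i
    using I that by (simp_all add: branchwise_def mem_N_set)
  have sub: "\<alpha> \<subseteq> Suc ` {..<length Vs}" "\<beta> \<subseteq> Suc ` {..<length Vs}"
    using assms(2,3) unfolding image_Suc_lessThan .
  have "Suc i \<in> \<alpha> \<longleftrightarrow> branch_part i I \<noteq> {}" if "i < length Vs" for i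
    using c(1)[OF that] by (metis contraction_eq_None_iff place_eq_None_iff)
  with sub(1) show "\<alpha> = Suc ` {i. i < length Vs \<and> branch_part i I \<noteq> {}}" by auto
  have "Suc i \<in> \<beta> \<longleftrightarrow> Leaves (Some (Vs ! i)) - branch_part i I \<noteq> {}" if "i < length Vs" for i
    using c(2)[OF that] by (metis contraction_eq_None_iff place_eq_None_iff)
  with sub(2) show "\<beta> = Suc ` {i. i < length Vs \<and> Leaves (Some (Vs ! i)) - branch_part i I \<noteq> {}}"
    by auto
qed

lemma card_N_set_graft:
  assumes Vs: "length Vs \<ge> 2" and S: "decomposition S Ss" and T: "decomposition T Ts"
  shows "card (N_set (Some S) (Some T) (Some (graft Vs))) =
    (\<Sum>(\<alpha>, \<beta>)\<in>Gamma_bar (length Vs) (length Ss) (length Ts). \<Prod>i<length Vs.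
       card (N_set (place (factors S Ss \<alpha>) \<alpha> (Suc i)) (place (factors T Ts \<beta>) \<beta> (Suc i)) (Some (Vs ! i))))"
proof -
  let ?G = "Gamma_bar (length Vs) (length Ss) (length Ts)"
  define X where "X = (\<lambda>(\<alpha>, \<beta>). branchwise Vs (place (factors S Ss \<alpha>) \<alpha>) (place (factors T Ts \<beta>) \<beta>))"
  have "finite (X p)" for p
    by (rule finite_subset[OF _ finite_Pow_iff[THEN iffD2, OF finite_Leaves[of "Some (graft Vs)"]]])
      (auto simp: X_def branchwise_def split: prod.splits)
  moreover have "X p \<inter> X q = {}" if p: "p \<in> ?G" and q: "q \<in> ?G" and neq: "p \<noteq> q" for p q
  proof (rule ccontr)
    assume "X p \<inter> X q \<noteq> {}"
    then obtain I where I: "I \<in> X p" "I \<in> X q" by blast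
    obtain \<alpha> \<beta> \<alpha>' \<beta>' where pq: "p = (\<alpha>, \<beta>)" "q = (\<alpha>', \<beta>')" by (cases p, cases q)
    have sub: "\<alpha> \<subseteq> {1..length Vs}" "\<beta> \<subseteq> {1..length Vs}"
      "\<alpha>' \<subseteq> {1..length Vs}" "\<beta>' \<subseteq> {1..length Vs}"
      using p q Gamma_bar_subset unfolding pq by blast+
    have I1: "I \<in> branchwise Vs (place (factors S Ss \<alpha>) \<alpha>) (place (factors T Ts \<beta>) \<beta>)"
      and I2: "I \<in> branchwise Vs (place (factors S Ss \<alpha>') \<alpha>') (place (factors T Ts \<beta>') \<beta>')"
      using I by (simp_all add: X_def pq)
    note pos1 = branchwise_place_positions[OF I1 sub(1,2)]
      and pos2 = branchwise_place_positions[OF I2 sub(3,4)]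
    have "\<alpha> = \<alpha>'" "\<beta> = \<beta>'"
      by (rule trans[OF pos1(1) pos2(1)[symmetric]], rule trans[OF pos1(2) pos2(2)[symmetric]])
    then show False using neq pq by simp
  qed
  ultimately have "card (\<Union>p\<in>?G. X p) = (\<Sum>p\<in>?G. card (X p))"
    by (intro card_UN_disjoint finite_Gamma_bar) auto
  then show ?thesis
    unfolding N_set_graft[OF assms] X_def by (simp add: card_branchwise[OF Vs] case_prod_unfold)
qed

text \<open>The coefficients at each basis tree \<open>W\<close> are compared; on the right only the
  summand whose k is the arity of the root of \<open>W\<close> contributes.\<close>

theorem proposition3p6:
  fixes S T :: prt and Ss Ts :: "prt list" and m n :: nat
  assumes "decomposition S Ss" and "m = length Ss"
    and "decomposition T Ts" and "n = length Ts"
  shows "(shuffle (Some S) (Some T) :: prt option \<Rightarrow>\<^sub>0 'k::field) =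
    (\<Sum>k = 2..n + m. \<Sum>(\<alpha>, \<beta>)\<in>Gamma_bar k m n. R_elem S Ss T Ts k \<alpha> \<beta>)"
proof (rule poly_mapping_eqI)
  fix W
  define ps :: "nat \<Rightarrow> nat set \<times> nat set \<Rightarrow> (prt option \<Rightarrow>\<^sub>0 'k) list" where
    "ps k p = map (P_factor (factors S Ss (fst p)) (factors T Ts (snd p)) (fst p) (snd p)) [1..<k + 1]" for k p
  have pos: "m \<ge> 1" "n \<ge> 1"
    using assms by (auto elim!: decomposition_cases)
  have len: "length (ps k p) = k" for k p by (simp add: ps_def)
  have nth: "ps k p ! i = P_factor (factors S Ss (fst p)) (factors T Ts (snd p)) (fst p) (snd p) (Suc i)"
    if "i < k" for k p i
    using that by (simp add: ps_def del: upt_Suc)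
  have "(\<Sum>k = 2..n + m. \<Sum>(\<alpha>, \<beta>)\<in>Gamma_bar k m n. R_elem S Ss T Ts k \<alpha> \<beta>) =
      (\<Sum>k = 2..n + m. \<Sum>p\<in>Gamma_bar k m n. grafting (ps k p))"
    by (intro sum.cong) (auto simp: ps_def assms R_elem_eq_grafting simp del: upt_Suc)
  then have rhs: "Poly_Mapping.lookup (\<Sum>k = 2..n + m. \<Sum>(\<alpha>, \<beta>)\<in>Gamma_bar k m n. R_elem S Ss T Ts k \<alpha> \<beta>) W =
      (\<Sum>k = 2..n + m. \<Sum>p\<in>Gamma_bar k m n. Poly_Mapping.lookup (grafting (ps k p)) W)"
    by (simp add: lookup_sum)
  show "Poly_Mapping.lookup (shuffle (Some S) (Some T) :: prt option \<Rightarrow>\<^sub>0 'k) W =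
      Poly_Mapping.lookup (\<Sum>k = 2..n + m. \<Sum>(\<alpha>, \<beta>)\<in>Gamma_bar k m n. R_elem S Ss T Ts k \<alpha> \<beta>) W"
  proof (cases "\<exists>Vs. length Vs \<ge> 2 \<and> W = Some (graft Vs)")
    case False
    then have "W = None \<or> W = Some x_tree" by (metis option.exhaust prt_cases)
    then have "N_set (Some S) (Some T) W = {}" using N_set_empty_tree N_set_x_tree by blast
    moreover have "Poly_Mapping.lookup (grafting (ps k p)) W = 0" if "k \<ge> 2" for k p
      using False that by (intro lookup_grafting_not_graft) (auto simp: len)
    ultimately show ?thesis unfolding rhs lookup_shuffle by simp
  next
    case True
    then obtain Vs where Vs: "length Vs \<ge> 2" "W = Some (graft Vs)" by blast
    let ?k = "length Vs"
    let ?c = "\<lambda>p. of_nat (\<Prod>i<?k. card (N_set (place (factors S Ss (fst p)) (fst p) (Suc i))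
      (place (factors T Ts (snd p)) (snd p) (Suc i)) (Some (Vs ! i)))) :: 'k"
    have "Poly_Mapping.lookup (grafting (ps k p)) W = (if k = ?k then ?c p else 0)"
      if k: "k \<ge> 2" and p: "p \<in> Gamma_bar k m n" for k p
    proof -
      have "fst p \<union> snd p = {1..k}" using p by (cases p) (simp add: Gamma_bar_iff)
      then have "Poly_Mapping.lookup (ps k p ! i) (Some (Vs ! i)) =
          of_nat (card (N_set (place (factors S Ss (fst p)) (fst p) (Suc i))
            (place (factors T Ts (snd p)) (snd p) (Suc i)) (Some (Vs ! i))))" if "i < k" for i
        using that nth by (simp add: lookup_P_factor)
      then show ?thesis
        using k Vs by (auto simp: lookup_grafting_graft len intro!: prod.cong)
    qed
    then have "(\<Sum>k = 2..n + m. \<Sum>p\<in>Gamma_bar k m n. Poly_Mapping.lookup (grafting (ps k p)) W) =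
        (\<Sum>k = 2..n + m. if k = ?k then \<Sum>p\<in>Gamma_bar ?k m n. ?c p else 0)"
      by (intro sum.cong) auto
    \<comment> \<open>If \<open>?k\<close> exceeds \<open>n + m\<close>, no index matches, and the
      right-hand side vanishes too because its index set is empty.\<close>
    also have "\<dots> = (\<Sum>p\<in>Gamma_bar ?k m n. ?c p)"
      using Vs(1) Gamma_bar_empty[OF pos, of ?k] by (auto simp: sum.delta)
    also have "\<dots> = of_nat (card (N_set (Some S) (Some T) W))"
      unfolding Vs(2) card_N_set_graft[OF Vs(1) assms(1,3)]
      by (simp add: assms case_prod_unfold)
    finally show ?thesis unfolding rhs lookup_shuffle by simp
  qed
qed

end
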